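(* Fix $\beta>0$, $\varepsilon\in(0,1/2]$ and set $p=\tfrac12+\varepsilon$. Let $(G_n)_{n\ge0}$ be the DRGVR with parameters $\beta,\varepsilon$, let $k_0$ be a vertex chosen uniformly at random from $V_n$, and let $D_n^0$ be the degree of $k_0$ in $G_n$. Let $a_0\sim\mathrm{Beta}(\tfrac{p}{2\varepsilon},1)$ and, conditionally on $a_0$, let $$X_0\sim \mathrm{Po}\Big(\frac{\beta p}{1-p}\Big(1-\frac{2p-1}{p}\,a_0^{(1-p)/(2\varepsilon)}\Big)\Big).$$ Then $$d_{\mathrm{TV}}(\mathfrak L(D_n^0),\mathfrak L(X_0))\le(\log\log n)^{-p/(2\varepsilon)}.$$
   Context: **DRGVR (Dynamic Random Graph with Vertex Removal).** Let $\beta>0$, $\varepsilon\in(0,1/2]$, $p=\tfrac12+\varepsilon$, and let $(\xi_n)$ be i.i.d. Bernoulli($p$). $G_0$ is the empty graph. For $n\ge1$, $G_n=(V_n,E_n)$ is built from $G_{n-1}=(V_{n-1},E_{n-1})$: if $\xi_n=1$, then $V_n=V_{n-1}\cup\{n\}$ and, conditionally on $V_{n-1}$, $E_n$ is obtained from $E_{n-1}$ by adding each edge $\{i,n\}$, $i\in V_{n-1}$, independently with probability $\min\{\beta/|V_{n-1}|,1\}$ (no edge is added if $V_{n-1}=\emptyset$); if $\xi_n=0$, a uniformly random vertex of $V_{n-1}$ (if any) is removed together with all its incident edges. $\mathrm{Po}(\lambda)$ is the Poisson distribution with parameter $\lambda$; $\mathfrak L$ denotes the law; $d_{\mathrm{TV}}(\mu_1,\mu_2)=\sup_A|\mu_1(A)-\mu_2(A)|$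 is the total variation distance. The variable $a_0$ is the type of the root in the local limit of $G_n$ rooted at $k_0$.
   Formalization: The bound is proved for all sufficiently large n (depending on β, ε), since it fails or is undefined for some small n; at ε=1/2 (p=1) the Poisson parameter, formally 0/0, is read as its limit β(1−log a_0); if V_n is empty the degree is taken as 0. *)

theory Defs
  imports "HOL-Probability.Probability" "HOL-Real_Asymp.Real_Asymp"
begin

section \<open>The dynamic random graph with vertex removal\<close>

type_synonym graph = "nat set \<times> nat set set"

definition degree :: "nat set set \<Rightarrow> nat \<Rightarrow> nat" where
  "degree E v = card {e \<in> E. v \<in> e}"

definition add_vertex :: "real \<Rightarrow> nat \<Rightarrow> graph \<Rightarrow> graph pmf" where
  "add_vertex \<beta> n = (\<lambda>(V, E).
     map_pmf (\<lambda>c. (insert n V, E \<union> {{i, n} | i. i \<in> V \<and> c i}))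
       (Pi_pmf V False (\<lambda>_. bernoulli_pmf (min (\<beta> / real (card V)) 1))))"

definition remove_vertex :: "graph \<Rightarrow> graph pmf" where
  "remove_vertex = (\<lambda>(V, E).
     if V = {} then return_pmf (V, E)
     else map_pmf (\<lambda>v. (V - {v}, {e \<in> E. v \<notin> e})) (pmf_of_set V))"

text \<open>
  The DRGVR is a Markov chain; \<open>drgvr \<beta> \<epsilon> n\<close> is the law of its state \<open>G\<^sub>n\<close>.
  The Bernoulli variable drawn in the recursion is \<open>\<xi>\<^bsub>n+1\<^esub>\<close>.
\<close>

primrec drgvr :: "real \<Rightarrow> real \<Rightarrow> nat \<Rightarrow> graph pmf" where
  "drgvr \<beta> \<epsilon> 0 = return_pmf ({}, {})"
| "drgvr \<beta> \<epsilon> (Suc n) =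
     bind_pmf (drgvr \<beta> \<epsilon> n) (\<lambda>G.
     bind_pmf (bernoulli_pmf (1 / 2 + \<epsilon>)) (\<lambda>\<xi>.
       if \<xi> then add_vertex \<beta> (Suc n) G else remove_vertex G))"

text \<open>
  The law of the degree of a uniformly random vertex of \<open>G\<^sub>n\<close>. If \<open>G\<^sub>n\<close> has no vertex,
  the degree is taken to be 0; since \<open>\<epsilon> > 0\<close>, this event has exponentially small probability
  in \<open>n\<close>.
\<close>

definition root_degree :: "real \<Rightarrow> real \<Rightarrow> nat \<Rightarrow> nat pmf" where
  "root_degree \<beta> \<epsilon> n =
     bind_pmf (drgvr \<beta> \<epsilon> n) (\<lambda>(V, E).
       if V = {} then return_pmf 0 else map_pmf (degree E) (pmf_of_set V))"


section \<open>The limiting mixed Poisson law\<close>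

text \<open>
  The Beta distribution lives on the open interval \<open>{0<..<1}\<close> rather than on all of \<open>real\<close>,
  so that the Poisson kernel below only has to make sense for parameters in that interval.
\<close>

definition beta_distribution :: "real \<Rightarrow> real \<Rightarrow> real measure" where
  "beta_distribution a b =
     density (restrict_space lborel {0<..<1})
       (\<lambda>x. ennreal (x powr (a - 1) * (1 - x) powr (b - 1) / Beta a b))"

text \<open>
  For \<open>\<epsilon> = 1 / 2\<close>, i.e. \<open>p = 1\<close>, the general formula is of the form \<open>0 / 0\<close>; it is then
  read as its limit for \<open>p \<rightarrow> 1\<close>, see \<open>limit_rate_continuous\<close> below.
\<close>

definition limit_rate :: "real \<Rightarrow> real \<Rightarrow> real \<Rightarrow> real" where
  "limit_rate \<beta> \<epsilon> a = (let p = 1 / 2 + \<epsilon> in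
     if p = 1 then \<beta> * (1 - ln a)
     else \<beta> * p / (1 - p) * (1 - (2 * p - 1) / p * a powr ((1 - p) / (2 * \<epsilon>))))"

definition limit_degree :: "real \<Rightarrow> real \<Rightarrow> nat measure" where
  "limit_degree \<beta> \<epsilon> = (let p = 1 / 2 + \<epsilon> in
     beta_distribution (p / (2 * \<epsilon>)) 1 \<bind>
       (\<lambda>a. measure_pmf (poisson_pmf (limit_rate \<beta> \<epsilon> a))))"

definition tv_dist :: "'a measure \<Rightarrow> 'a measure \<Rightarrow> real" where
  "tv_dist M N = (SUP A\<in>sets M. \<bar>measure M A - measure N A\<bar>)"


section \<open>Well-definedness of the limiting law\<close>

lemma limit_rate_continuous:
  assumes "a > 0"
  shows "((\<lambda>\<epsilon>. limit_rate \<beta> \<epsilon> a) \<longlongrightarrow> limit_rate \<beta> (1 / 2) a) (at_left (1 / 2))"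
proof -
  have "((\<lambda>\<epsilon>. \<beta> * (1 / 2 + \<epsilon>) / (1 - (1 / 2 + \<epsilon>)) *
          (1 - (2 * (1 / 2 + \<epsilon>) - 1) / (1 / 2 + \<epsilon>) * a powr ((1 - (1 / 2 + \<epsilon>)) / (2 * \<epsilon>))))
        \<longlongrightarrow> \<beta> * (1 - ln a)) (at_left (1 / 2))"
    using assms by real_asymp
  moreover have "\<forall>\<^sub>F \<epsilon> in at_left (1 / 2). \<epsilon> < (1 / 2 :: real)"
    by (simp add: eventually_at_filter)
  ultimately show ?thesis
    by (subst tendsto_cong[where g = "\<lambda>\<epsilon>. \<beta> * (1 / 2 + \<epsilon>) / (1 - (1 / 2 + \<epsilon>)) *
          (1 - (2 * (1 / 2 + \<epsilon>) - 1) / (1 / 2 + \<epsilon>) * a powr ((1 - (1 / 2 + \<epsilon>)) / (2 * \<epsilon>)))"])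
      (auto simp: limit_rate_def Let_def elim!: eventually_mono)
qed

lemma limit_rate_pos:
  assumes "\<beta> > 0" "0 < \<epsilon>" "\<epsilon> \<le> 1 / 2" "0 < a" "a < 1"
  shows "limit_rate \<beta> \<epsilon> a > 0"
proof (cases "\<epsilon> = 1 / 2")
  case True
  have "\<beta> * (1 - ln a) > 0" using assms ln_less_zero[of a] by (intro mult_pos_pos) linarith+
  then show ?thesis using True assms by (simp add: limit_rate_def)
next
  case False
  define p where "p = 1 / 2 + \<epsilon>"
  have p: "0 < p" "p < 1" "2 * p - 1 > 0" using False assms by (auto simp: p_def)
  have "(2 * p - 1) / p < 1" "(2 * p - 1) / p > 0" using p by (auto simp: field_simps)
  moreover have "a powr ((1 - p) / (2 * \<epsilon>)) \<le> 1"
    using assms p by (intro powr_le1) auto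
  moreover have "a powr ((1 - p) / (2 * \<epsilon>)) > 0" using assms by simp
  ultimately have "(2 * p - 1) / p * a powr ((1 - p) / (2 * \<epsilon>)) < 1"
    by (smt (verit) mult_left_le)
  then show ?thesis
    using p assms(1) by (simp add: limit_rate_def p_def[symmetric] Let_def)
qed

lemma prob_space_beta_distribution:
  assumes "a > 0" "b > 0"
  shows "prob_space (beta_distribution a b)"
proof
  have B: "Beta a b > 0" using assms by (simp add: Beta_def Gamma_real_pos)
  have "((\<lambda>x. x powr (a - 1) * (1 - x) powr (b - 1) / Beta a b) has_integral 1) {0..1}"
    using has_integral_divide[OF has_integral_Beta_real[OF assms], of "Beta a b"] B by simp
  then have "((\<lambda>x. x powr (a - 1) * (1 - x) powr (b - 1) / Beta a b) has_integral 1) {0<..<1}"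
    by (simp add: has_integral_Icc_iff_Ioo)
  then have "((\<lambda>x. if x \<in> {0<..<1} then x powr (a - 1) * (1 - x) powr (b - 1) / Beta a b else 0)
      has_integral 1) UNIV"
    by (subst has_integral_restrict_UNIV)
  then have *: "(\<integral>\<^sup>+x. ennreal (if x \<in> {0<..<1} then x powr (a - 1) * (1 - x) powr (b - 1) / Beta a b else 0)
      \<partial>lborel) = ennreal 1"
    by (intro nn_integral_has_integral_lborel) (use B in auto)
  have "emeasure (beta_distribution a b) (space (beta_distribution a b)) =
      (\<integral>\<^sup>+x. ennreal (x powr (a - 1) * (1 - x) powr (b - 1) / Beta a b) \<partial>restrict_space lborel {0<..<1})"
    unfolding beta_distribution_def
    by (subst emeasure_density)
       (auto intro!: measurable_restrict_space1 nn_integral_cong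
         simp: indicator_def sets_restrict_space_iff)
  also have "\<dots> = (\<integral>\<^sup>+x. ennreal (if x \<in> {0<..<1} then x powr (a - 1) * (1 - x) powr (b - 1) / Beta a b else 0)
      \<partial>lborel)"
    by (subst nn_integral_restrict_space) (auto intro!: nn_integral_cong simp: indicator_def)
  finally show "emeasure (beta_distribution a b) (space (beta_distribution a b)) = 1"
    using * by simp
qed

lemma poisson_kernel_measurable:
  assumes "\<beta> > 0" "0 < \<epsilon>" "\<epsilon> \<le> 1 / 2"
  shows "(\<lambda>a. measure_pmf (poisson_pmf (limit_rate \<beta> \<epsilon> a)))
           \<in> beta_distribution r s \<rightarrow>\<^sub>M subprob_algebra (count_space UNIV)"
proof (rule measurable_subprob_algebra)
  fix A :: "nat set"
  have rate [measurable]: "limit_rate \<beta> \<epsilon> \<in> borel_measurable borel"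
    unfolding limit_rate_def Let_def by measurable
  have [measurable]: "limit_rate \<beta> \<epsilon> \<in> borel_measurable (beta_distribution r s)"
    unfolding beta_distribution_def
    by (simp add: measurable_restrict_space1)
  have "(\<lambda>a. \<Sum>k. ennreal (limit_rate \<beta> \<epsilon> a ^ k / fact k * exp (- limit_rate \<beta> \<epsilon> a)) * indicator A k)
          \<in> borel_measurable (beta_distribution r s)"
    by measurable
  also have "?this \<longleftrightarrow> (\<lambda>a. emeasure (measure_pmf (poisson_pmf (limit_rate \<beta> \<epsilon> a))) A)
          \<in> borel_measurable (beta_distribution r s)"
  proof (rule measurable_cong)
    fix a assume "a \<in> space (beta_distribution r s)"
    then have "limit_rate \<beta> \<epsilon> a > 0"
      using assms by (intro limit_rate_pos) (auto simp: beta_distribution_def space_restrict_space)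
    then show "(\<Sum>k. ennreal (limit_rate \<beta> \<epsilon> a ^ k / fact k * exp (- limit_rate \<beta> \<epsilon> a)) * indicator A k)
        = emeasure (measure_pmf (poisson_pmf (limit_rate \<beta> \<epsilon> a))) A"
      by (simp add: nn_integral_pmf[symmetric] nn_integral_count_space_indicator
            nn_integral_count_space_nat)
  qed
  finally show "(\<lambda>a. emeasure (measure_pmf (poisson_pmf (limit_rate \<beta> \<epsilon> a))) A)
          \<in> borel_measurable (beta_distribution r s)" .
qed (auto intro: prob_space_imp_subprob_space measure_pmf.prob_space_axioms)

lemma
  assumes "\<beta> > 0" "0 < \<epsilon>" "\<epsilon> \<le> 1 / 2"
  shows prob_space_limit_degree: "prob_space (limit_degree \<beta> \<epsilon>)"
    and sets_limit_degree: "sets (limit_degree \<beta> \<epsilon>) = UNIV"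
    and emeasure_limit_degree: "emeasure (limit_degree \<beta> \<epsilon>) A =
      (\<integral>\<^sup>+a. emeasure (measure_pmf (poisson_pmf (limit_rate \<beta> \<epsilon> a))) A
        \<partial>beta_distribution ((1 / 2 + \<epsilon>) / (2 * \<epsilon>)) 1)"
proof -
  let ?B = "beta_distribution ((1 / 2 + \<epsilon>) / (2 * \<epsilon>)) 1"
  interpret B: prob_space ?B
    using assms by (intro prob_space_beta_distribution) auto
  note kernel = poisson_kernel_measurable[OF assms, of "(1 / 2 + \<epsilon>) / (2 * \<epsilon>)" 1]
  show "prob_space (limit_degree \<beta> \<epsilon>)"
    unfolding limit_degree_def Let_def
    by (intro B.prob_space_bind[OF _ kernel]) (simp add: measure_pmf.prob_space_axioms)
  show "sets (limit_degree \<beta> \<epsilon>) = UNIV"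
    unfolding limit_degree_def Let_def by (subst sets_bind) (auto simp: B.not_empty)
  show "emeasure (limit_degree \<beta> \<epsilon>) A =
      (\<integral>\<^sup>+a. emeasure (measure_pmf (poisson_pmf (limit_rate \<beta> \<epsilon> a))) A \<partial>?B)"
    unfolding limit_degree_def Let_def
    by (intro emeasure_bind[OF B.not_empty kernel]) simp
qed

end

theory Submission
  imports Defs
begin

text \<open>
  The number of vertices \<open>M\<close> together with the degree \<open>D\<close> of a uniformly random root is itself a Markov
  chain: an arrival makes the new vertex the root with probability \<open>1 / (M + 1)\<close>, in which case
  \<open>D\<close> is binomial, and otherwise raises \<open>D\<close> with probability \<open>\<beta> / M\<close>; a removal lowers
  \<open>D\<close> with probability \<open>D / (M - 1)\<close>. Averaged over the coin \<open>\<xi>\<close> and with \<open>M\<close> replaced by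
  \<open>2 * \<epsilon> * n\<close>, a step is a small multiple \<open>s = 1 / (2 * \<epsilon> * n)\<close> of an immigration-death process with
  resets to \<open>Po(\<beta>)\<close> at rate \<open>p\<close>. The mixed Poisson law is stationary for that process, because its
  balance equations are the integrated derivative of \<open>a powr (p / (2 * \<epsilon>)) * Po(rate a)\<close>.
  The resets contract the total variation distance to the limit by the factor
  \<open>1 - p * s \<le> 1 - 1 / n\<close> in every step, while the fluctuations of \<open>M\<close>, which are of order
  \<open>sqrt n\<close>, cost only \<open>O(n powr (- 3 / 2))\<close>. Hence the distance is \<open>O(1 / sqrt n)\<close>.
\<close>

section \<open>Reduction to a Markov chain\<close>

text \<open>The root is redrawn uniformly at every time, so it is the one-time laws of (M, D) that
  follow a recursion; this is all the claim speaks of.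

  The estimates are dual: they are carried by test functions f with values in [0, 1] that vanish
  from some K on. With M frozen, a step is a reset of probability p * s, identical for both laws,
  plus a kernel of mass 1 - p * s, so it contracts without any coupling. Finite support removes all
  questions of summation and survives a step with K raised by one.

  The obstacle is that the error of freezing M grows with D, because each edge of the root is lost
  separately, and that D and M are dependent. The cost is of the order of D * |M - 2 * \<epsilon> *
  n| / n^2, a joint moment. For this reason the mean degree is bounded against every nonnegative
  weight g M, which reduces the product to the fluctuation of M alone.

  The recursion e(n+1) <= (1 - 1/n) * e(n) + O(n^(-3/2)) has solutions of order n^(-1/2): the
  contraction by itself would decay like 1/n, so the error terms decide. This is far below every
  negative power of ln (ln n).\<close>

definition graph_on :: "nat \<Rightarrow> graph \<Rightarrow> bool" where
  "graph_on n = (\<lambda>(V, E). V \<subseteq> {1..n} \<and> E \<subseteq> {{i, j} | i j. i \<in> V \<and> j \<in> V \<and> i \<noteq> j})"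

lemma finite_graph_on: "graph_on n (V, E) \<Longrightarrow> finite V"
  by (auto simp: graph_on_def intro: finite_subset)

lemma graph_on_add_vertex:
  assumes "graph_on n G" "H \<in> set_pmf (add_vertex \<beta> (Suc n) G)"
  shows "graph_on (Suc n) H"
proof -
  obtain V E where G: "G = (V, E)" by (cases G)
  obtain c where c: "H = (insert (Suc n) V, E \<union> {{i, Suc n} | i. i \<in> V \<and> c i})"
    using assms(2) by (auto simp: G add_vertex_def)
  have V: "V \<subseteq> {1..n}" and E: "E \<subseteq> {{i, j} | i j. i \<in> V \<and> j \<in> V \<and> i \<noteq> j}"
    using assms(1) by (auto simp: G graph_on_def)
  have "Suc n \<notin> V" using V by auto
  then have "{{i, Suc n} | i. i \<in> V \<and> c i} \<subseteq>
      {{i, j} | i j. i \<in> insert (Suc n) V \<and> j \<in> insert (Suc n) V \<and> i \<noteq> j}"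
    by blast
  moreover have "E \<subseteq> {{i, j} | i j. i \<in> insert (Suc n) V \<and> j \<in> insert (Suc n) V \<and> i \<noteq> j}"
    using E by blast
  ultimately show ?thesis using V unfolding c graph_on_def by auto
qed

lemma graph_on_remove_vertex:
  assumes "graph_on n G" "H \<in> set_pmf (remove_vertex G)"
  shows "graph_on (Suc n) H"
proof -
  obtain V E where G: "G = (V, E)" by (cases G)
  have V: "V \<subseteq> {1..n}" and E: "E \<subseteq> {{i, j} | i j. i \<in> V \<and> j \<in> V \<and> i \<noteq> j}"
    using assms(1) by (auto simp: G graph_on_def)
  show ?thesis
  proof (cases "V = {}")
    case True
    then show ?thesis using assms V E by (auto simp: G graph_on_def remove_vertex_def)
  next
    case False
    then obtain v where H: "H = (V - {v}, {e \<in> E. v \<notin> e})"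
      using assms(2) finite_graph_on[OF assms(1)[unfolded G]] by (auto simp: G remove_vertex_def)
    have "{e \<in> E. v \<notin> e} \<subseteq> {{i, j} | i j. i \<in> V - {v} \<and> j \<in> V - {v} \<and> i \<noteq> j}"
    proof
      fix e assume e: "e \<in> {e \<in> E. v \<notin> e}"
      then obtain i j where "e = {i, j}" "i \<in> V" "j \<in> V" "i \<noteq> j" using E by blast
      then show "e \<in> {{i, j} | i j. i \<in> V - {v} \<and> j \<in> V - {v} \<and> i \<noteq> j}" using e by blast
    qed
    then show ?thesis using V unfolding H graph_on_def by auto
  qed
qed

lemma graph_on_drgvr: "G \<in> set_pmf (drgvr \<beta> \<epsilon> n) \<Longrightarrow> graph_on n G"
proof (induction n arbitrary: G)
  case 0
  then show ?case by (simp add: graph_on_def)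
next
  case (Suc n)
  then show ?case
    by (auto split: if_splits intro: graph_on_add_vertex graph_on_remove_vertex)
qed

text \<open>Counting vertices instead of edges gives the probability that a uniformly chosen other
  vertex is a neighbour.\<close>

lemma degree_eq_card_neighbours:
  assumes "graph_on n (V, E)" "w \<in> V"
  shows "degree E w = card {v \<in> V - {w}. {v, w} \<in> E}"
proof -
  have E: "E \<subseteq> {{i, j} | i j. i \<in> V \<and> j \<in> V \<and> i \<noteq> j}"
    using assms(1) by (auto simp: graph_on_def)
  have "bij_betw (\<lambda>v. {v, w}) {v \<in> V - {w}. {v, w} \<in> E} {e \<in> E. w \<in> e}"
    unfolding bij_betw_def
  proof
    show "inj_on (\<lambda>v. {v, w}) {v \<in> V - {w}. {v, w} \<in> E}"
      by (auto simp: inj_on_def doubleton_eq_iff)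
    show "(\<lambda>v. {v, w}) ` {v \<in> V - {w}. {v, w} \<in> E} = {e \<in> E. w \<in> e}"
    proof (intro equalityI subsetI)
      fix e assume e: "e \<in> {e \<in> E. w \<in> e}"
      then obtain i j where ij: "e = {i, j}" "i \<in> V" "j \<in> V" "i \<noteq> j" using E by blast
      then have "w = i \<or> w = j" using e by auto
      then show "e \<in> (\<lambda>v. {v, w}) ` {v \<in> V - {w}. {v, w} \<in> E}"
      proof
        assume "w = i"
        then have "e = {j, w}" "j \<in> V - {w}" using ij by auto
        then show ?thesis using e by blast
      next
        assume "w = j"
        then have "e = {i, w}" "i \<in> V - {w}" using ij by auto
        then show ?thesis using e by blast
      qed
    qed auto
  qed
  then show ?thesis by (simp add: degree_def bij_betw_same_card)
qed

lemma degree_le_card: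
  assumes "graph_on n (V, E)" "w \<in> V"
  shows "degree E w \<le> card V - 1"
proof -
  have "card {v \<in> V - {w}. {v, w} \<in> E} \<le> card (V - {w})"
    using finite_graph_on[OF assms(1)] by (intro card_mono) auto
  then show ?thesis
    using assms finite_graph_on[OF assms(1)] by (simp add: degree_eq_card_neighbours)
qed

text \<open>The value (0, 0) for the empty graph agrees with the degree 0 that
  \<open>root_degree\<close> assigns to it.\<close>

definition root_law :: "graph \<Rightarrow> (nat \<times> nat) pmf" where
  "root_law = (\<lambda>(V, E).
     if V = {} then return_pmf (0, 0) else map_pmf (\<lambda>v. (card V, degree E v)) (pmf_of_set V))"

definition size_degree :: "real \<Rightarrow> real \<Rightarrow> nat \<Rightarrow> (nat \<times> nat) pmf" where
  "size_degree \<beta> \<epsilon> n = bind_pmf (drgvr \<beta> \<epsilon> n) root_law"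

lemma root_degree_eq: "root_degree \<beta> \<epsilon> n = map_pmf snd (size_degree \<beta> \<epsilon> n)"
  unfolding root_degree_def size_degree_def map_bind_pmf
  by (intro bind_pmf_cong refl) (auto simp: root_law_def map_pmf_comp)

section \<open>Transition kernels for the size and the root degree\<close>

definition link_prob :: "real \<Rightarrow> nat \<Rightarrow> real" where
  "link_prob \<beta> m = min (\<beta> / real m) 1"

lemma link_prob_bounds: "\<beta> \<ge> 0 \<Longrightarrow> 0 \<le> link_prob \<beta> m" "link_prob \<beta> m \<le> 1"
  by (auto simp: link_prob_def)

text \<open>For an old root only the coin of its own edge to the new vertex matters; a new root sees
  all m coins, hence the binomial law.\<close>

definition arrive :: "real \<Rightarrow> nat \<times> nat \<Rightarrow> (nat \<times> nat) pmf" where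
  "arrive \<beta> = (\<lambda>(m, d). bind_pmf (bernoulli_pmf (1 / real (Suc m))) (\<lambda>r.
     if r then map_pmf (Pair (Suc m)) (binomial_pmf m (link_prob \<beta> m))
     else map_pmf (\<lambda>b. (Suc m, if b then Suc d else d)) (bernoulli_pmf (link_prob \<beta> m))))"

text \<open>The denominator is m - 1 because the removed vertex is uniform among the vertices other
  than the surviving root. For m <= 1 the next graph is empty.\<close>

definition depart :: "nat \<times> nat \<Rightarrow> (nat \<times> nat) pmf" where
  "depart = (\<lambda>(m, d). if m \<le> 1 then return_pmf (0, 0)
     else map_pmf (\<lambda>b. (m - 1, if b then d - 1 else d)) (bernoulli_pmf (real d / real (m - 1))))"

lemma pmf_of_set_insert:
  assumes "finite V" "x \<notin> V" "V \<noteq> {}"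
  shows "pmf_of_set (insert x V) =
    bind_pmf (bernoulli_pmf (1 / real (Suc (card V)))) (\<lambda>r. if r then return_pmf x else pmf_of_set V)"
proof (rule pmf_eqI)
  fix y
  define c where "c = real (card V)"
  have c: "c > 0" using assms by (auto simp: c_def card_gt_0_iff)
  have "pmf (bind_pmf (bernoulli_pmf (1 / (1 + c))) (\<lambda>r. if r then return_pmf x else pmf_of_set V)) y
      = indicator {x} y / (1 + c) + indicator V y / c * (1 - 1 / (1 + c))"
    using assms c by (simp add: pmf_bind c_def indicator_def)
  also have "1 - 1 / (1 + c) = c / (1 + c)" using c by (simp add: field_simps)
  also have "indicator {x} y / (1 + c) + indicator V y / c * (c / (1 + c)) =
      indicator (insert x V) y / (1 + c)"
    using c assms by (auto simp: indicator_def)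
  finally show "pmf (pmf_of_set (insert x V)) y = pmf (bind_pmf (bernoulli_pmf (1 / real (Suc (card V))))
      (\<lambda>r. if r then return_pmf x else pmf_of_set V)) y"
    using assms by (simp add: c_def)
qed

lemma map_pmf_of_set_pred:
  assumes "finite A" "A \<noteq> {}"
  shows "map_pmf P (pmf_of_set A) = bernoulli_pmf (card {x \<in> A. P x} / card A)"
proof (rule pmf_eqI)
  fix b
  have c: "card A > 0" using assms by auto
  have le: "card {x \<in> A. P x} \<le> card A" using assms by (intro card_mono) auto
  have *: "pmf (map_pmf P (pmf_of_set A)) True = card {x \<in> A. P x} / card A"
  proof -
    have "A \<inter> P -` {True} = {x \<in> A. P x}" by auto
    then show ?thesis using assms by (simp add: pmf_map measure_pmf_of_set)
  qed
  have "pmf (map_pmf P (pmf_of_set A)) False = 1 - pmf (map_pmf P (pmf_of_set A)) True"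
    by (rule pmf_False_conv_True)
  then show "pmf (map_pmf P (pmf_of_set A)) b = pmf (bernoulli_pmf (card {x \<in> A. P x} / card A)) b"
    using * c le by (cases b) simp_all
qed

text \<open>Both sides are images of the uniform law on ordered pairs of distinct elements, which is
  invariant under swapping. It serves to exchange the removed vertex with the root.\<close>

lemma pmf_of_set_pair_swap:
  assumes "finite V" "card V \<ge> 2"
  shows "bind_pmf (pmf_of_set V) (\<lambda>v. map_pmf (f v) (pmf_of_set (V - {v}))) =
    bind_pmf (pmf_of_set V) (\<lambda>w. map_pmf (\<lambda>v. f v w) (pmf_of_set (V - {w})))"
proof -
  have ne: "V \<noteq> {}" using assms by auto
  have ne': "V - {v} \<noteq> {}" if "v \<in> V" for v
  proof
    assume "V - {v} = {}"
    then have "V = {v}" using that by auto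
    then show False using assms by simp
  qed
  have fst: "bind_pmf (pmf_of_set V) (\<lambda>v. map_pmf (Pair v) (pmf_of_set (V - {v}))) =
      pmf_of_set (SIGMA v:V. V - {v})"
  proof -
    have "pmf_of_set (\<Union>v\<in>V. Pair v ` (V - {v})) =
        bind_pmf (pmf_of_set V) (\<lambda>v. pmf_of_set (Pair v ` (V - {v})))"
      by (rule pmf_of_set_UN[where n = "card V - 1"])
        (use assms ne ne' in \<open>auto simp: disjoint_family_on_def card_image inj_on_def\<close>)
    also have "\<dots> = bind_pmf (pmf_of_set V) (\<lambda>v. map_pmf (Pair v) (pmf_of_set (V - {v})))"
      by (intro bind_pmf_cong refl, subst map_pmf_of_set_inj)
        (use assms ne ne' in \<open>auto simp: inj_on_def\<close>)
    also have "(\<Union>v\<in>V. Pair v ` (V - {v})) = (SIGMA v:V. V - {v})" by auto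
    finally show ?thesis by simp
  qed
  obtain v0 where v0: "v0 \<in> V" using ne by auto
  have nonempty: "(SIGMA v:V. V - {v}) \<noteq> {}" using v0 ne'[OF v0] by blast
  have "map_pmf prod.swap (pmf_of_set (SIGMA v:V. V - {v})) =
      pmf_of_set (prod.swap ` (SIGMA v:V. V - {v}))"
    using nonempty assms by (intro map_pmf_of_set_inj) (auto simp: inj_on_def)
  also have "prod.swap ` (SIGMA v:V. V - {v}) = (SIGMA v:V. V - {v})" by (auto simp: image_iff)
  finally have swap: "map_pmf prod.swap (pmf_of_set (SIGMA v:V. V - {v})) =
      pmf_of_set (SIGMA v:V. V - {v})" .
  have "bind_pmf (pmf_of_set V) (\<lambda>v. map_pmf (f v) (pmf_of_set (V - {v}))) =
      map_pmf (case_prod f) (pmf_of_set (SIGMA v:V. V - {v}))"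
    unfolding fst[symmetric] map_bind_pmf by (simp add: map_pmf_comp)
  also have "\<dots> = map_pmf (\<lambda>(w, v). f v w) (pmf_of_set (SIGMA v:V. V - {v}))"
    by (subst swap[symmetric]) (simp add: map_pmf_comp case_prod_unfold)
  also have "\<dots> = bind_pmf (pmf_of_set V) (\<lambda>w. map_pmf (\<lambda>v. f v w) (pmf_of_set (V - {w})))"
    unfolding fst[symmetric] map_bind_pmf by (simp add: map_pmf_comp)
  finally show ?thesis .
qed

lemma degree_add_vertex:
  assumes "graph_on n (V, E)"
  shows "degree (E \<union> {{i, Suc n} | i. i \<in> V \<and> c i}) (Suc n) = card {i \<in> V. c i}"
    and "v \<in> V \<Longrightarrow> degree (E \<union> {{i, Suc n} | i. i \<in> V \<and> c i}) v =
           (if c v then Suc (degree E v) else degree E v)"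
proof -
  have V: "V \<subseteq> {1..n}" and E: "E \<subseteq> {{i, j} | i j. i \<in> V \<and> j \<in> V \<and> i \<noteq> j}"
    using assms by (auto simp: graph_on_def)
  have new: "Suc n \<notin> V" using V by auto
  have E_new: "Suc n \<notin> e" if "e \<in> E" for e using E new that by fastforce
  have "finite E"
  proof (rule finite_subset)
    show "E \<subseteq> Pow V" using E by fastforce
    show "finite (Pow V)" using finite_graph_on[OF assms] by simp
  qed
  have "{e \<in> E \<union> {{i, Suc n} | i. i \<in> V \<and> c i}. Suc n \<in> e} = (\<lambda>i. {i, Suc n}) ` {i \<in> V. c i}"
    using E_new by auto
  moreover have "inj_on (\<lambda>i. {i, Suc n}) {i \<in> V. c i}"
    using new by (auto simp: inj_on_def doubleton_eq_iff)
  ultimately show "degree (E \<union> {{i, Suc n} | i. i \<in> V \<and> c i}) (Suc n) = card {i \<in> V. c i}"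
    by (simp add: degree_def card_image)
  assume v: "v \<in> V"
  then have "v \<noteq> Suc n" using new by auto
  then have "{e \<in> E \<union> {{i, Suc n} | i. i \<in> V \<and> c i}. v \<in> e} =
      (if c v then insert {v, Suc n} {e \<in> E. v \<in> e} else {e \<in> E. v \<in> e})"
    using v by auto
  moreover have "{v, Suc n} \<notin> E" using E_new by auto
  ultimately show "degree (E \<union> {{i, Suc n} | i. i \<in> V \<and> c i}) v =
           (if c v then Suc (degree E v) else degree E v)"
    using \<open>finite E\<close> by (simp add: degree_def)
qed

text \<open>The root and the edge coins are independent, so the root can be drawn first; whether it
  is the new vertex then decides which coins its degree depends on.\<close>

lemma root_law_add_vertex:
  assumes "graph_on n G" "\<beta> \<ge> 0"
  shows "bind_pmf (add_vertex \<beta> (Suc n) G) root_law = bind_pmf (root_law G) (arrive \<beta>)"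
proof -
  obtain V E where G: "G = (V, E)" by (cases G)
  note good = assms(1)[unfolded G]
  have fin: "finite V" using finite_graph_on[OF good] .
  have new: "Suc n \<notin> V" using good by (auto simp: graph_on_def)
  show ?thesis
  proof (cases "V = {}")
    case True
    then have "E = {}" using good by (auto simp: graph_on_def)
    have one: "bernoulli_pmf 1 = return_pmf True"
    proof (rule pmf_eqI)
      show "pmf (bernoulli_pmf 1) b = pmf (return_pmf True) b" for b by (cases b) simp_all
    qed
    \<comment> \<open>Here \<open>\<beta> / 0 = 0\<close>, and the arrival is the root with
      probability 1 / 1, so both sides are the point mass at (1, 0).\<close>
    have zero: "link_prob \<beta> 0 = 0" by (simp add: link_prob_def)
    show ?thesis using True \<open>E = {}\<close>
      by (simp add: G add_vertex_def root_law_def arrive_def bind_return_pmf map_pmf_def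
          bind_assoc_pmf pmf_of_set_singleton degree_def binomial_pmf_0 zero one)
  next
    case False
    define m where "m = card V"
    define q where "q = link_prob \<beta> m"
    have q: "q \<in> {0..1}" using link_prob_bounds[of \<beta> m] assms(2) by (simp add: q_def)
    define P where "P = Pi_pmf V False (\<lambda>_. bernoulli_pmf q)"
    define EE where "EE = (\<lambda>c. E \<union> {{i, Suc n} | i. i \<in> V \<and> c i})"
    have "bind_pmf (add_vertex \<beta> (Suc n) G) root_law =
        bind_pmf P (\<lambda>c. map_pmf (\<lambda>v. (Suc m, degree (EE c) v)) (pmf_of_set (insert (Suc n) V)))"
      using fin new
      by (simp add: G add_vertex_def bind_map_pmf root_law_def P_def q_def m_def EE_def link_prob_def)
    also have "\<dots> = bind_pmf (bernoulli_pmf (1 / real (Suc m))) (\<lambda>r. bind_pmf P (\<lambda>c.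
        map_pmf (\<lambda>v. (Suc m, degree (EE c) v)) (if r then return_pmf (Suc n) else pmf_of_set V)))"
      unfolding pmf_of_set_insert[OF fin new False] map_bind_pmf m_def[symmetric]
      by (rule bind_commute_pmf)
    also have "\<dots> = bind_pmf (bernoulli_pmf (1 / real (Suc m))) (\<lambda>r.
        if r then map_pmf (Pair (Suc m)) (binomial_pmf m q)
        else bind_pmf (pmf_of_set V) (\<lambda>v.
          map_pmf (\<lambda>b. (Suc m, if b then Suc (degree E v) else degree E v)) (bernoulli_pmf q)))"
    proof (intro bind_pmf_cong refl)
      fix r
      show "bind_pmf P (\<lambda>c. map_pmf (\<lambda>v. (Suc m, degree (EE c) v))
          (if r then return_pmf (Suc n) else pmf_of_set V)) =
        (if r then map_pmf (Pair (Suc m)) (binomial_pmf m q)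
        else bind_pmf (pmf_of_set V) (\<lambda>v.
          map_pmf (\<lambda>b. (Suc m, if b then Suc (degree E v) else degree E v)) (bernoulli_pmf q)))"
      proof (cases r)
        case True
        have "bind_pmf P (\<lambda>c. map_pmf (\<lambda>v. (Suc m, degree (EE c) v)) (return_pmf (Suc n))) =
            map_pmf (Pair (Suc m)) (map_pmf (\<lambda>c. card {i \<in> V. c i}) P)"
          using degree_add_vertex(1)[OF good]
          by (simp add: EE_def map_pmf_def[symmetric] map_pmf_comp)
        also have "map_pmf (\<lambda>c. card {i \<in> V. c i}) P = binomial_pmf m q"
          unfolding P_def by (rule binomial_pmf_altdef'[symmetric]) (use fin q m_def in auto)
        finally show ?thesis using True by simp
      next
        case False
        have "bind_pmf P (\<lambda>c. map_pmf (\<lambda>v. (Suc m, degree (EE c) v)) (pmf_of_set V)) =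
            bind_pmf (pmf_of_set V) (\<lambda>v. map_pmf (\<lambda>c. (Suc m, degree (EE c) v)) P)"
          unfolding map_pmf_def by (rule bind_commute_pmf)
        also have "\<dots> = bind_pmf (pmf_of_set V) (\<lambda>v. map_pmf (\<lambda>b. (Suc m, if b then Suc (degree E v)
            else degree E v)) (map_pmf (\<lambda>c. c v) P))"
          using degree_add_vertex(2)[OF good] \<open>V \<noteq> {}\<close> fin
          unfolding map_pmf_comp EE_def
          by (intro bind_pmf_cong map_pmf_cong refl) simp
        also have "\<dots> = bind_pmf (pmf_of_set V) (\<lambda>v. map_pmf (\<lambda>b. (Suc m, if b then Suc (degree E v)
            else degree E v)) (bernoulli_pmf q))"
          unfolding P_def using \<open>V \<noteq> {}\<close> fin
          by (intro bind_pmf_cong refl) (simp add: Pi_pmf_component)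
        finally show ?thesis using False by simp
      qed
    qed
    also have "\<dots> = bind_pmf (bernoulli_pmf (1 / real (Suc m))) (\<lambda>r. bind_pmf (pmf_of_set V) (\<lambda>v.
        if r then map_pmf (Pair (Suc m)) (binomial_pmf m q)
        else map_pmf (\<lambda>b. (Suc m, if b then Suc (degree E v) else degree E v)) (bernoulli_pmf q)))"
      by (intro bind_pmf_cong refl) simp
    also have "\<dots> = bind_pmf (pmf_of_set V) (\<lambda>v. arrive \<beta> (m, degree E v))"
      unfolding arrive_def q_def[symmetric] prod.case by (rule bind_commute_pmf)
    also have "\<dots> = bind_pmf (root_law G) (arrive \<beta>)"
      using False by (simp add: G root_law_def bind_map_pmf m_def)
    finally show ?thesis .
  qed
qed

lemma degree_remove_vertex:
  assumes "graph_on n (V, E)" "w \<in> V" "v \<in> V - {w}"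
  shows "degree {e \<in> E. v \<notin> e} w = (if {v, w} \<in> E then degree E w - 1 else degree E w)"
proof -
  have E: "E \<subseteq> {{i, j} | i j. i \<in> V \<and> j \<in> V \<and> i \<noteq> j}"
    using assms by (auto simp: graph_on_def)
  have "{e \<in> {e \<in> E. v \<notin> e}. w \<in> e} = {e \<in> E. w \<in> e} - {{v, w}}"
  proof (intro equalityI subsetI)
    fix e assume e: "e \<in> {e \<in> E. w \<in> e} - {{v, w}}"
    then obtain i j where "e = {i, j}" using E by blast
    then have "v \<notin> e" using e assms(3) by auto
    then show "e \<in> {e \<in> {e \<in> E. v \<notin> e}. w \<in> e}" using e by auto
  qed auto
  then show ?thesis
    by (auto simp: degree_def card_Diff_singleton_if)
qed

text \<open>Removing v and then choosing a root w among the rest is the same as choosing w first and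
  v among the others. The degree of w drops exactly if v is a neighbour.\<close>

lemma root_law_remove_vertex:
  assumes "graph_on n G"
  shows "bind_pmf (remove_vertex G) root_law = bind_pmf (root_law G) depart"
proof -
  obtain V E where G: "G = (V, E)" by (cases G)
  note good = assms(1)[unfolded G]
  have fin: "finite V" using finite_graph_on[OF good] .
  consider "V = {}" | v where "V = {v}" | "card V \<ge> 2"
    using fin by (metis One_nat_def card_1_singletonE card_eq_0_iff less_2_cases not_le)
  then show ?thesis
  proof cases
    case 1
    then show ?thesis by (simp add: G remove_vertex_def root_law_def bind_return_pmf depart_def)
  next
    case 2
    then show ?thesis
      by (simp add: G remove_vertex_def root_law_def bind_return_pmf depart_def map_pmf_def
          pmf_of_set_singleton)
  next
    case 3
    then have ne: "V \<noteq> {}" by auto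
    have ne': "V - {w} \<noteq> {}" if "w \<in> V" for w
    proof
      assume "V - {w} = {}"
      then have "V = {w}" using that by auto
      then show False using 3 by simp
    qed
    have "bind_pmf (remove_vertex G) root_law =
       bind_pmf (pmf_of_set V) (\<lambda>v. root_law (V - {v}, {e \<in> E. v \<notin> e}))"
      using ne by (simp add: G remove_vertex_def bind_map_pmf)
    also have "\<dots> = bind_pmf (pmf_of_set V) (\<lambda>v. map_pmf (\<lambda>w. (card V - 1, degree {e \<in> E. v \<notin> e} w))
         (pmf_of_set (V - {v})))"
    proof (intro bind_pmf_cong refl)
      fix v assume "v \<in> set_pmf (pmf_of_set V)"
      then have "v \<in> V" using ne fin by simp
      then show "root_law (V - {v}, {e \<in> E. v \<notin> e}) =
          map_pmf (\<lambda>w. (card V - 1, degree {e \<in> E. v \<notin> e} w)) (pmf_of_set (V - {v}))"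
        unfolding root_law_def prod.case if_not_P[OF ne'[OF \<open>v \<in> V\<close>]] using fin by simp
    qed
    also have "\<dots> = bind_pmf (pmf_of_set V) (\<lambda>w. map_pmf (\<lambda>v. (card V - 1, degree {e \<in> E. v \<notin> e} w))
         (pmf_of_set (V - {w})))"
      by (rule pmf_of_set_pair_swap[OF fin 3])
    also have "\<dots> = bind_pmf (pmf_of_set V) (\<lambda>w. depart (card V, degree E w))"
    proof (intro bind_pmf_cong refl)
      fix w assume "w \<in> set_pmf (pmf_of_set V)"
      then have w: "w \<in> V" using ne fin by simp
      have "map_pmf (\<lambda>v. (card V - 1, degree {e \<in> E. v \<notin> e} w)) (pmf_of_set (V - {w})) =
          map_pmf (\<lambda>b. (card V - 1, if b then degree E w - 1 else degree E w))
            (map_pmf (\<lambda>v. {v, w} \<in> E) (pmf_of_set (V - {w})))"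
        unfolding map_pmf_comp
      proof (intro map_pmf_cong refl)
        fix v assume "v \<in> set_pmf (pmf_of_set (V - {w}))"
        then have "v \<in> V - {w}" using ne'[OF w] fin by (subst (asm) set_pmf_of_set) auto
        then show "(card V - 1, degree {e \<in> E. v \<notin> e} w) =
            (card V - 1, if {v, w} \<in> E then degree E w - 1 else degree E w)"
          using degree_remove_vertex[OF good w] by simp
      qed
      also have "map_pmf (\<lambda>v. {v, w} \<in> E) (pmf_of_set (V - {w})) =
          bernoulli_pmf (real (degree E w) / real (card V - 1))"
        using ne'[OF w] fin w
        by (subst map_pmf_of_set_pred) (auto simp: degree_eq_card_neighbours[OF good w])
      finally show "map_pmf (\<lambda>v. (card V - 1, degree {e \<in> E. v \<notin> e} w)) (pmf_of_set (V - {w})) =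
          depart (card V, degree E w)"
        using 3 by (simp add: depart_def)
    qed
    also have "\<dots> = bind_pmf (root_law G) depart"
      using ne by (simp add: G root_law_def bind_map_pmf)
    finally show ?thesis .
  qed
qed

lemma size_degree_0: "size_degree \<beta> \<epsilon> 0 = return_pmf (0, 0)"
  by (simp add: size_degree_def bind_return_pmf root_law_def)

text \<open>\<open>root_law\<close> intertwines the graph kernels with \<open>arrive\<close> and
  \<open>depart\<close>, so the law of the pair evolves without reference to the rest of the
  graph.\<close>

lemma size_degree_Suc:
  assumes "\<beta> \<ge> 0"
  shows "size_degree \<beta> \<epsilon> (Suc n) = bind_pmf (size_degree \<beta> \<epsilon> n) (\<lambda>x.
    bind_pmf (bernoulli_pmf (1 / 2 + \<epsilon>)) (\<lambda>\<xi>. if \<xi> then arrive \<beta> x else depart x))"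
proof -
  have "size_degree \<beta> \<epsilon> (Suc n) = bind_pmf (drgvr \<beta> \<epsilon> n) (\<lambda>G.
      bind_pmf (bernoulli_pmf (1 / 2 + \<epsilon>)) (\<lambda>\<xi>.
        if \<xi> then bind_pmf (add_vertex \<beta> (Suc n) G) root_law else bind_pmf (remove_vertex G) root_law))"
    unfolding size_degree_def drgvr.simps bind_assoc_pmf
    by (intro bind_pmf_cong refl) auto
  also have "\<dots> = bind_pmf (drgvr \<beta> \<epsilon> n) (\<lambda>G.
      bind_pmf (bernoulli_pmf (1 / 2 + \<epsilon>)) (\<lambda>\<xi>.
        bind_pmf (root_law G) (\<lambda>x. if \<xi> then arrive \<beta> x else depart x)))"
    using root_law_add_vertex[OF graph_on_drgvr assms] root_law_remove_vertex[OF graph_on_drgvr]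
    by (intro bind_pmf_cong refl) auto
  also have "\<dots> = bind_pmf (drgvr \<beta> \<epsilon> n) (\<lambda>G. bind_pmf (root_law G) (\<lambda>x.
      bind_pmf (bernoulli_pmf (1 / 2 + \<epsilon>)) (\<lambda>\<xi>. if \<xi> then arrive \<beta> x else depart x)))"
    by (intro bind_pmf_cong refl bind_commute_pmf)
  also have "\<dots> = bind_pmf (size_degree \<beta> \<epsilon> n) (\<lambda>x.
      bind_pmf (bernoulli_pmf (1 / 2 + \<epsilon>)) (\<lambda>\<xi>. if \<xi> then arrive \<beta> x else depart x))"
    by (simp add: size_degree_def bind_assoc_pmf)
  finally show ?thesis .
qed

text \<open>The bound on d makes d / (m - 1) in \<open>depart\<close> a probability, and both bounds
  together give finite support, hence integrability of every function.\<close>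

lemma set_size_degree:
  assumes "(m, d) \<in> set_pmf (size_degree \<beta> \<epsilon> n)"
  shows "m \<le> n" "d \<le> m - 1"
proof -
  obtain V E where VE: "(V, E) \<in> set_pmf (drgvr \<beta> \<epsilon> n)" "(m, d) \<in> set_pmf (root_law (V, E))"
    using assms by (auto simp: size_degree_def)
  note good = graph_on_drgvr[OF VE(1)]
  have "V \<subseteq> {1..n}" using good by (auto simp: graph_on_def)
  then have "card V \<le> n" using card_mono[of "{1..n}" V] by simp
  then show "m \<le> n" "d \<le> m - 1"
    using VE(2) degree_le_card[OF good] finite_graph_on[OF good]
    by (auto simp: root_law_def split: if_splits)
qed

lemma finite_set_size_degree: "finite (set_pmf (size_degree \<beta> \<epsilon> n))"
proof (rule finite_subset)
  show "set_pmf (size_degree \<beta> \<epsilon> n) \<subseteq> {..n} \<times> {..n}"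
    using set_size_degree by fastforce
qed simp


section \<open>Moments of the chain\<close>

lemma expectation_bind_pmf_finite:
  fixes g :: "'b \<Rightarrow> real"
  assumes "finite (set_pmf M)" "\<And>x. x \<in> set_pmf M \<Longrightarrow> finite (set_pmf (N x))"
  shows "measure_pmf.expectation (bind_pmf M N) g =
    measure_pmf.expectation M (\<lambda>x. measure_pmf.expectation (N x) g)"
  using assms by (subst pmf_expectation_bind[of "set_pmf M"])
    (auto simp: integral_measure_pmf[of "set_pmf M"])

lemma expectation_binomial_pmf_id:
  assumes "q \<in> {0..1}"
  shows "measure_pmf.expectation (binomial_pmf m q) real = real m * q"
proof (cases m)
  case 0
  then show ?thesis using assms by (simp add: binomial_pmf_0)
next
  case (Suc l)
  have "measure_pmf.expectation (binomial_pmf m q) real =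
      (\<Sum>k\<le>Suc l. real (Suc l choose k) * q ^ k * (1 - q) ^ (Suc l - k) * real k)"
    using assms by (simp add: expectation_binomial_pmf' Suc)
  also have "\<dots> = (\<Sum>k\<le>l. real (Suc l choose Suc k) * q ^ Suc k * (1 - q) ^ (l - k) * real (Suc k))"
    by (subst sum.atMost_Suc_shift) simp
  also have "\<dots> = real (Suc l) * q * (\<Sum>k\<le>l. real (l choose k) * q ^ k * (1 - q) ^ (l - k))"
    unfolding sum_distrib_left
  proof (rule sum.cong[OF refl])
    fix k
    have "real (Suc k) * real (Suc l choose Suc k) = real (Suc l) * real (l choose k)"
      using Suc_times_binomial_eq[of l k] by (simp only: of_nat_mult[symmetric] mult.commute)
    then show "real (Suc l choose Suc k) * q ^ Suc k * (1 - q) ^ (l - k) * real (Suc k) =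
        real (Suc l) * q * (real (l choose k) * q ^ k * (1 - q) ^ (l - k))"
      by (simp add: mult_ac)
  qed
  also have "(\<Sum>k\<le>l. real (l choose k) * q ^ k * (1 - q) ^ (l - k)) = 1"
    using binomial_ring[of q "1 - q" l] by simp
  finally show ?thesis by (simp add: Suc)
qed

lemma finite_set_arrive:
  assumes "\<beta> \<ge> 0"
  shows "finite (set_pmf (arrive \<beta> x))"
  using assms link_prob_bounds[of \<beta>]
  by (cases x) (auto simp: arrive_def intro!: finite_set_pmf_binomial_pmf)

lemma finite_set_depart: "finite (set_pmf (depart x))"
  by (cases x) (auto simp: depart_def)

lemma expectation_arrive:
  assumes "\<beta> \<ge> 0"
  shows "measure_pmf.expectation (arrive \<beta> (m, d)) g =
    (measure_pmf.expectation (binomial_pmf m (link_prob \<beta> m)) (\<lambda>k. g (Suc m, k)) +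
      real m * (link_prob \<beta> m * g (Suc m, Suc d) + (1 - link_prob \<beta> m) * g (Suc m, d))) / real (Suc m)"
proof -
  define B where "B = measure_pmf.expectation (binomial_pmf m (link_prob \<beta> m)) (\<lambda>k. g (Suc m, k))"
  define D where "D = link_prob \<beta> m * g (Suc m, Suc d) + (1 - link_prob \<beta> m) * g (Suc m, d)"
  note q = link_prob_bounds[of \<beta> m]
  have "measure_pmf.expectation (arrive \<beta> (m, d)) g =
      B * (1 / real (Suc m)) + D * (1 - 1 / real (Suc m))"
    unfolding arrive_def prod.case using assms q
    by (subst expectation_bind_pmf_finite)
      (auto simp: B_def D_def mult.commute intro!: finite_set_pmf_binomial_pmf)
  also have "1 - 1 / real (Suc m) = real m / real (Suc m)" by (simp add: field_simps)
  finally show ?thesis by (simp add: B_def D_def add_divide_distrib mult.commute)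
qed

lemma expectation_depart:
  assumes "d \<le> m - 1"
  shows "measure_pmf.expectation (depart (m, d)) g =
    (if m \<le> 1 then g (0, 0)
     else real d / real (m - 1) * g (m - 1, d - 1) + (1 - real d / real (m - 1)) * g (m - 1, d))"
proof (cases "m \<le> 1")
  case False
  then have "real d / real (m - 1) \<le> 1" using assms by (simp add: divide_le_eq_1)
  then show ?thesis using False by (simp add: depart_def mult.commute)
qed (simp add: depart_def)

section \<open>Size and mean degree of the chain\<close>

locale drgvr_params =
  fixes \<beta> \<epsilon> p :: real
  assumes beta_pos: "\<beta> > 0" and eps_pos: "\<epsilon> > 0" and eps_le: "\<epsilon> \<le> 1 / 2"
    and p_def: "p = 1 / 2 + \<epsilon>"
begin

lemma p_bounds: "0 < p" "p \<le> 1" "2 * \<epsilon> \<le> p" "2 * p - 1 = 2 * \<epsilon>"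
  using eps_pos eps_le by (auto simp: p_def)

abbreviation E :: "nat \<Rightarrow> (nat \<times> nat \<Rightarrow> real) \<Rightarrow> real" where
  "E n g \<equiv> measure_pmf.expectation (size_degree \<beta> \<epsilon> n) g"

lemma integrable_E: "integrable (measure_pmf (size_degree \<beta> \<epsilon> n)) (g :: _ \<Rightarrow> real)"
  by (intro integrable_measure_pmf_finite finite_set_size_degree)

lemma E_mono:
  assumes "\<And>m d. m \<le> n \<Longrightarrow> d \<le> m - 1 \<Longrightarrow> f (m, d) \<le> g (m, d)"
  shows "E n f \<le> E n g"
  using assms set_size_degree
  by (intro integral_mono_AE integrable_E) (auto simp: AE_measure_pmf_iff)

lemma E_cong:
  assumes "\<And>m d. m \<le> n \<Longrightarrow> d \<le> m - 1 \<Longrightarrow> f (m, d) = g (m, d)"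
  shows "E n f = E n g"
  using assms by (intro antisym E_mono) auto

lemma E_add: "E n (\<lambda>x. f x + g x) = E n f + E n g"
  by (intro Bochner_Integration.integral_add integrable_E)

lemma E_diff: "E n (\<lambda>x. f x - g x) = E n f - E n g"
  by (intro Bochner_Integration.integral_diff integrable_E)

lemma E_Suc:
  "E (Suc n) g = E n (\<lambda>x. p * measure_pmf.expectation (arrive \<beta> x) g +
     (1 - p) * measure_pmf.expectation (depart x) g)"
proof -
  have fin: "finite (set_pmf (if \<xi> then arrive \<beta> x else depart x))" for \<xi> x
    using finite_set_arrive[of \<beta>] finite_set_depart beta_pos by auto
  have "E (Suc n) g = E n (\<lambda>x. measure_pmf.expectation
      (bind_pmf (bernoulli_pmf p) (\<lambda>\<xi>. if \<xi> then arrive \<beta> x else depart x)) g)"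
    unfolding size_degree_Suc[OF less_imp_le[OF beta_pos]] p_def[symmetric]
    using fin by (intro expectation_bind_pmf_finite finite_set_size_degree) (auto simp: set_bind_pmf)
  also have "\<dots> = E n (\<lambda>x. p * measure_pmf.expectation (arrive \<beta> x) g +
     (1 - p) * measure_pmf.expectation (depart x) g)"
    using fin p_bounds by (simp add: expectation_bind_pmf_finite mult.commute)
  finally show ?thesis .
qed

text \<open>Truncated subtraction encodes that a removal leaves the empty graph unchanged.\<close>

lemma E_size_Suc:
  "E (Suc n) (\<lambda>x. \<phi> (fst x)) = E n (\<lambda>x. p * \<phi> (Suc (fst x)) + (1 - p) * \<phi> (fst x - 1))"
  unfolding E_Suc
proof (rule E_cong, goal_cases)
  case (1 m d)
  have "measure_pmf.expectation (arrive \<beta> (m, d)) (\<lambda>x. \<phi> (fst x)) = \<phi> (Suc m)"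
    using beta_pos by (simp add: expectation_arrive field_simps)
  moreover have "measure_pmf.expectation (depart (m, d)) (\<lambda>x. \<phi> (fst x)) = \<phi> (m - 1)"
    using 1(2) by (subst expectation_depart) (auto simp: algebra_simps)
  ultimately show ?case by simp
qed

text \<open>The size is a random walk with steps 1 and -1 and a floor at 0. The floor only increases
  the size, so the exponential moment of the walk without floor is an upper bound.\<close>

lemma E_exp_size_le:
  assumes "\<theta> \<ge> 0"
  shows "E n (\<lambda>x. exp (- \<theta> * real (fst x))) \<le> (p * exp (- \<theta>) + (1 - p) * exp \<theta>) ^ n"
proof (induction n)
  case 0
  then show ?case by (simp add: size_degree_0)
next
  case (Suc n)
  define \<rho> where "\<rho> = p * exp (- \<theta>) + (1 - p) * exp \<theta>"
  have "\<rho> \<ge> 0" using p_bounds by (simp add: \<rho>_def)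
  have "E (Suc n) (\<lambda>x. exp (- \<theta> * real (fst x))) \<le> E n (\<lambda>x. \<rho> * exp (- \<theta> * real (fst x)))"
    unfolding E_size_Suc[where \<phi> = "\<lambda>m. exp (- \<theta> * real m)"]
  proof (rule E_mono, goal_cases)
    case (1 m d)
    have a: "exp (- \<theta> * real (Suc m)) = exp (- \<theta>) * exp (- \<theta> * real m)"
      by (simp add: exp_add[symmetric] algebra_simps)
    have "- \<theta> * real (m - 1) \<le> \<theta> + - \<theta> * real m"
      using assms by (cases m) (auto simp: algebra_simps)
    then have b: "exp (- \<theta> * real (m - 1)) \<le> exp \<theta> * exp (- \<theta> * real m)"
      by (subst exp_add[symmetric]) simp
    show ?case unfolding fst_conv a \<rho>_def
      using mult_left_mono[OF b, of "1 - p"] p_bounds by (simp add: algebra_simps)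
  qed
  also have "\<dots> = \<rho> * E n (\<lambda>x. exp (- \<theta> * real (fst x)))" by simp
  also have "\<dots> \<le> \<rho> * \<rho> ^ n"
    using Suc \<open>\<rho> \<ge> 0\<close> by (intro mult_left_mono) (auto simp: \<rho>_def)
  finally show ?case by (simp add: \<rho>_def)
qed

text \<open>Away from 0 the centred step has mean 0 and variance 1 - 4 * \<epsilon>^2, so each step
  adds at most 1. The moment is taken around 2 * \<epsilon> * n, which differs from the true mean
  because of the floor.\<close>

lemma E_size_variance_le: "E n (\<lambda>x. (real (fst x) - 2 * \<epsilon> * real n)\<^sup>2) \<le> real n"
proof (induction n)
  case 0
  then show ?case by (simp add: size_degree_0)
next
  case (Suc n)
  have "E (Suc n) (\<lambda>x. (real (fst x) - 2 * \<epsilon> * real (Suc n))\<^sup>2) \<le>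
      E n (\<lambda>x. (real (fst x) - 2 * \<epsilon> * real n)\<^sup>2 + 1)"
    unfolding E_size_Suc[where \<phi> = "\<lambda>m. (real m - 2 * \<epsilon> * real (Suc n))\<^sup>2"]
  proof (rule E_mono, goal_cases)
    case (1 m d)
    define y where "y = real m - 2 * \<epsilon> * real n"
    show ?case
    proof (cases "m = 0")
      case True
      \<comment> \<open>At the floor the centred step has mean 1/2 - \<epsilon> >= 0. Since y <= 0
        there, this drift points towards the centre and its cross term only helps.\<close>
      then have y: "y \<le> 0" using eps_pos by (simp add: y_def)
      have "p * (real (Suc m) - 2 * \<epsilon> * real (Suc n))\<^sup>2 + (1 - p) * (real (m - 1) - 2 * \<epsilon> * real (Suc n))\<^sup>2
          = p * (y + 1 - 2 * \<epsilon>)\<^sup>2 + (1 - p) * (y - 2 * \<epsilon>)\<^sup>2"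
        by (intro arg_cong2[where f = "(+)"] arg_cong2[where f = "(*)"] arg_cong[where f = "\<lambda>z. z\<^sup>2"] refl)
          (use True in \<open>auto simp: y_def algebra_simps\<close>)
      also have "\<dots> = y\<^sup>2 + 2 * y * (1 / 2 - \<epsilon>) + (1 / 2 - \<epsilon>)"
        unfolding p_def by (simp add: power2_eq_square field_simps)
      also have "\<dots> \<le> y\<^sup>2 + 1"
        using mult_nonpos_nonneg[OF y, of "1 / 2 - \<epsilon>"] eps_le eps_pos by (simp add: algebra_simps)
      finally show ?thesis by (simp add: y_def)
    next
      case False
      then have "p * (real (Suc m) - 2 * \<epsilon> * real (Suc n))\<^sup>2 + (1 - p) * (real (m - 1) - 2 * \<epsilon> * real (Suc n))\<^sup>2
          = p * (y + 1 - 2 * \<epsilon>)\<^sup>2 + (1 - p) * (y - 1 - 2 * \<epsilon>)\<^sup>2"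
        by (simp add: y_def algebra_simps of_nat_diff)
      also have "\<dots> = y\<^sup>2 + 1 - 4 * \<epsilon>\<^sup>2"
        unfolding p_def by (simp add: power2_eq_square field_simps)
      also have "\<dots> \<le> y\<^sup>2 + 1" by simp
      finally show ?thesis by (simp add: y_def)
    qed
  qed
  also have "\<dots> \<le> real (Suc n)" using Suc by (simp add: E_add)
  finally show ?case .
qed

text \<open>An arrival creates at most \<open>\<beta>\<close> edges on average, so it preserves a mean degree of at most
  \<open>2 * \<beta>\<close>, and a removal decreases the mean degree.\<close>

lemma E_degree_le:
  assumes "\<And>m. g m \<ge> 0"
  shows "E n (\<lambda>(m, d). real d * g m) \<le> 2 * \<beta> * E n (\<lambda>x. g (fst x))"
  using assms
proof (induction n arbitrary: g)
  case 0
  then show ?case using beta_pos by (simp add: size_degree_0)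
next
  case (Suc n)
  \<comment> \<open>\<open>h\<close> is the weight g pulled back through a step in which the root
    survives; it depends on m in a new way, so the induction has to range over all weights.
    \<open>r\<close> counts the expected new edges twice, once for a fresh root and once for an old
    one, which produces the constant 2 * \<beta>.\<close>
  define h where "h = (\<lambda>m. p * g (Suc m) * (real m / real (Suc m)) + (1 - p) * g (m - 1))"
  define r where "r = (\<lambda>m. p * g (Suc m) * (2 * \<beta> / real (Suc m)))"
  have "h m \<ge> 0" for m using Suc.prems p_bounds by (simp add: h_def)
  have "E (Suc n) (\<lambda>(m, d). real d * g m) \<le> E n (\<lambda>x. (case x of (m, d) \<Rightarrow> real d * h m) + r (fst x))"
    unfolding E_Suc
  proof (rule E_mono, goal_cases)
    case (1 m d)
    define b where "b = link_prob \<beta> m"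
    have b: "0 \<le> b" "b \<le> 1" "real m * b \<le> \<beta>"
      using link_prob_bounds[of \<beta> m] beta_pos
      by (auto simp: b_def link_prob_def field_simps min_def)
    have "measure_pmf.expectation (arrive \<beta> (m, d)) (\<lambda>(m, d). real d * g m) =
        (real m * b * g (Suc m) + real m * (b * (real (Suc d) * g (Suc m)) + (1 - b) * (real d * g (Suc m)))) / real (Suc m)"
      using beta_pos b
      by (simp add: expectation_arrive b_def[symmetric] expectation_binomial_pmf_id[simplified])
    also have "\<dots> = g (Suc m) * ((real m * real d + 2 * (real m * b)) / real (Suc m))"
      by (simp add: field_simps)
    also have "\<dots> \<le> g (Suc m) * ((real m * real d + 2 * \<beta>) / real (Suc m))"
      using b Suc.prems by (intro mult_left_mono divide_right_mono) auto
    finally have a: "measure_pmf.expectation (arrive \<beta> (m, d)) (\<lambda>(m, d). real d * g m) \<le>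
        g (Suc m) * ((real m * real d + 2 * \<beta>) / real (Suc m))" .
    have c: "measure_pmf.expectation (depart (m, d)) (\<lambda>(m, d). real d * g m) \<le> real d * g (m - 1)"
    proof (cases "m \<le> 1")
      case True
      then show ?thesis using 1 Suc.prems by (simp add: expectation_depart)
    next
      case False
      define c where "c = real d / real (m - 1)"
      have "c \<ge> 0" by (simp add: c_def)
      have "measure_pmf.expectation (depart (m, d)) (\<lambda>(m, d). real d * g m) =
          (c * real (d - 1) + (1 - c) * real d) * g (m - 1)"
        using False 1 by (simp add: expectation_depart c_def algebra_simps)
      also have "\<dots> \<le> real d * g (m - 1)"
      proof (rule mult_right_mono)
        have "c * real (d - 1) \<le> c * real d" using \<open>c \<ge> 0\<close> by (intro mult_left_mono) auto
        then show "c * real (d - 1) + (1 - c) * real d \<le> real d" by (simp add: algebra_simps)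
      qed (rule Suc.prems)
      finally show ?thesis .
    qed
    have "p * measure_pmf.expectation (arrive \<beta> (m, d)) (\<lambda>(m, d). real d * g m) +
        (1 - p) * measure_pmf.expectation (depart (m, d)) (\<lambda>(m, d). real d * g m) \<le>
        p * (g (Suc m) * ((real m * real d + 2 * \<beta>) / real (Suc m))) + (1 - p) * (real d * g (m - 1))"
      using a c p_bounds by (intro add_mono mult_left_mono) auto
    also have "\<dots> = real d * h m + r m"
      by (simp add: h_def r_def add_divide_distrib algebra_simps)
    finally show ?case by simp
  qed
  also have "\<dots> = E n (\<lambda>(m, d). real d * h m) + E n (\<lambda>x. r (fst x))" by (rule E_add)
  also have "\<dots> \<le> 2 * \<beta> * E n (\<lambda>x. h (fst x)) + E n (\<lambda>x. r (fst x))"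
    using Suc.IH[of h] \<open>\<And>m. h m \<ge> 0\<close> by simp
  also have "\<dots> = E n (\<lambda>x. 2 * \<beta> * h (fst x) + r (fst x))" by (simp add: E_add)
  also have "\<dots> = E n (\<lambda>x. 2 * \<beta> * (p * g (Suc (fst x)) + (1 - p) * g (fst x - 1)))"
  proof (rule E_cong, goal_cases)
    case (1 m d)
    \<comment> \<open>The weights of a surviving and of a fresh root recombine here, so that the
      bound 2 * \<beta> reproduces itself.\<close>
    have one: "real m / real (Suc m) + 1 / real (Suc m) = 1" by (simp add: field_simps)
    have "2 * \<beta> * h m + r m =
        2 * \<beta> * (p * g (Suc m) * (real m / real (Suc m) + 1 / real (Suc m)) + (1 - p) * g (m - 1))"
      by (simp add: h_def r_def algebra_simps)
    then show ?case unfolding one by simp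
  qed
  also have "\<dots> = 2 * \<beta> * E (Suc n) (\<lambda>x. g (fst x))" by (simp add: E_size_Suc)
  finally show ?case .
qed

end


section \<open>Poisson approximation of the binomial distribution\<close>

text \<open>Bounding the binomial coefficient by m^k / k! and (1 - q)^m by exp (- \<beta>) leaves a
  Poisson weight with the parameter inflated to \<beta> / (1 - q), but the old
  normalisation.\<close>

lemma pmf_binomial_le_poisson:
  assumes "\<beta> > 0" "real m > \<beta>"
  defines "q \<equiv> \<beta> / real m"
  shows "pmf (binomial_pmf m q) k \<le> exp (- \<beta>) * (\<beta> / (1 - q)) ^ k / fact k"
proof -
  have q: "0 < q" "q < 1" using assms by (auto simp: q_def field_simps)
  have m: "m > 0" using assms by (cases m) auto
  have "pmf (binomial_pmf m q) k = real (m choose k) * q ^ k * (1 - q) ^ (m - k)"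
    using q by simp
  also have "\<dots> \<le> (real m ^ k / fact k) * q ^ k * (1 - q) ^ (m - k)"
  proof (intro mult_right_mono)
    have "fact k * (m choose k) \<le> m ^ k"
      by (metis binomial_fact_lemma binomial_eq_0 binomial_fact_pow mult.commute)
    then have "real (fact k * (m choose k)) \<le> real (m ^ k)" by (simp only: of_nat_le_iff)
    then show "real (m choose k) \<le> real m ^ k / fact k" by (simp add: field_simps)
  qed (use q in auto)
  also have "\<dots> = \<beta> ^ k / fact k * (1 - q) ^ (m - k)"
    using m by (simp add: q_def power_divide)
  also have "\<dots> \<le> \<beta> ^ k / fact k * (exp (- \<beta>) / (1 - q) ^ k)"
  proof (intro mult_left_mono)
    \<comment> \<open>For k > m the truncated difference is 0; the estimate persists because m - k +
      k >= m in every case.\<close>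
    have "(1 - q) ^ (m - k) * (1 - q) ^ k = (1 - q) ^ (m - k + k)" by (simp add: power_add)
    also have "\<dots> \<le> (1 - q) ^ m" using q by (intro power_decreasing) auto
    also have "\<dots> \<le> exp (- q) ^ m" using q exp_ge_add_one_self[of "- q"] by (intro power_mono) auto
    also have "\<dots> = exp (- \<beta>)" using m by (simp add: exp_of_nat_mult[symmetric] q_def)
    finally show "(1 - q) ^ (m - k) \<le> exp (- \<beta>) / (1 - q) ^ k"
      using q by (simp add: pos_le_divide_eq)
  qed (use assms in auto)
  finally show ?thesis by (simp add: power_divide field_simps)
qed

lemma sums_expectation_pmf_nat:
  fixes g :: "nat \<Rightarrow> real"
  assumes "integrable (measure_pmf M) g"
  shows "(\<lambda>k. pmf M k * g k) sums measure_pmf.expectation M g"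
proof -
  have "integrable (count_space UNIV) (\<lambda>k. pmf M k * g k)"
    using assms unfolding measure_pmf_eq_density by (simp add: integrable_density)
  then have "(\<lambda>k. pmf M k * g k) sums (\<integral>k. pmf M k * g k \<partial>count_space UNIV)"
    by (rule sums_integral_count_space_nat)
  also have "(\<integral>k. pmf M k * g k \<partial>count_space UNIV) = measure_pmf.expectation M g"
    unfolding measure_pmf_eq_density by (subst integral_density) auto
  finally show ?thesis .
qed

text \<open>Only the positive part of the difference of the weights has to be summed.\<close>

lemma expectation_binomial_poisson_le:
  assumes "\<beta> > 0" "real m \<ge> 2 * \<beta>" "\<And>k. 0 \<le> f k" "\<And>k. f k \<le> 1"
  shows "measure_pmf.expectation (binomial_pmf m (\<beta> / real m)) f -
    measure_pmf.expectation (poisson_pmf \<beta>) f \<le> exp (2 * \<beta>\<^sup>2 / real m) - 1"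
proof -
  define q where "q = \<beta> / real m"
  have m: "real m > 0" using assms by linarith
  have q: "0 < q" "q \<le> 1 / 2" using assms m by (auto simp: q_def field_simps)
  have int: "integrable (measure_pmf M) f" for M :: "nat pmf"
    using assms by (intro measure_pmf.integrable_const_bound[where B = 1]) auto
  \<comment> \<open>\<open>c\<close> majorises both weights. Its total mass is exp (\<beta> * q / (1
    - q)), and the excess of this over 1 bounds the difference of the expectations.\<close>
  define c where "c = (\<lambda>k. exp (- \<beta>) * (\<beta> / (1 - q)) ^ k / fact k)"
  have c: "c sums (exp (- \<beta>) * exp (\<beta> / (1 - q)))"
    using sums_mult[OF exp_converges[of "\<beta> / (1 - q)"], of "exp (- \<beta>)"]
    by (simp add: c_def divide_inverse mult_ac)
  have "pmf (poisson_pmf \<beta>) sums 1"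
    using sums_expectation_pmf_nat[of "poisson_pmf \<beta>" "\<lambda>_. 1"] by simp
  then have s1: "(\<lambda>k. c k - pmf (poisson_pmf \<beta>) k) sums (exp (- \<beta>) * exp (\<beta> / (1 - q)) - 1)"
    by (intro sums_diff c)
  have s2: "(\<lambda>k. pmf (binomial_pmf m q) k * f k - pmf (poisson_pmf \<beta>) k * f k) sums
      (measure_pmf.expectation (binomial_pmf m q) f - measure_pmf.expectation (poisson_pmf \<beta>) f)"
    by (intro sums_diff sums_expectation_pmf_nat int)
  have le: "pmf (binomial_pmf m q) k * f k - pmf (poisson_pmf \<beta>) k * f k \<le>
      c k - pmf (poisson_pmf \<beta>) k" for k
  proof -
    have "pmf (poisson_pmf \<beta>) k = exp (- \<beta>) * \<beta> ^ k / fact k" using assms by simp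
    also have "\<dots> \<le> c k"
      unfolding c_def using assms q
      by (intro divide_right_mono mult_left_mono power_mono) (auto simp: field_simps)
    finally have pc: "pmf (poisson_pmf \<beta>) k \<le> c k" .
    have "pmf (binomial_pmf m q) k \<le> c k"
      unfolding c_def q_def using assms m by (intro pmf_binomial_le_poisson) auto
    then have "(pmf (binomial_pmf m q) k - pmf (poisson_pmf \<beta>) k) * f k \<le>
        (c k - pmf (poisson_pmf \<beta>) k) * f k"
      using assms by (intro mult_right_mono) auto
    also have "\<dots> \<le> (c k - pmf (poisson_pmf \<beta>) k) * 1"
      using pc assms by (intro mult_left_mono) auto
    finally show ?thesis by (simp add: algebra_simps)
  qed
  have "measure_pmf.expectation (binomial_pmf m q) f -
      measure_pmf.expectation (poisson_pmf \<beta>) f \<le> exp (- \<beta>) * exp (\<beta> / (1 - q)) - 1"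
    by (rule sums_le[OF le s2 s1])
  also have "exp (- \<beta>) * exp (\<beta> / (1 - q)) = exp (- \<beta> + \<beta> / (1 - q))" by (rule exp_add[symmetric])
  also have "- \<beta> + \<beta> / (1 - q) = \<beta> * q / (1 - q)" using q by (simp add: field_simps)
  also have "exp (\<beta> * q / (1 - q)) \<le> exp (\<beta> * q / (1 / 2))"
    unfolding exp_le_cancel_iff using q assms by (intro divide_left_mono) auto
  also have "\<beta> * q / (1 / 2) = 2 * \<beta>\<^sup>2 / real m" by (simp add: q_def power2_eq_square)
  finally show ?thesis by (simp add: q_def)
qed

text \<open>The one-sided bound applied to 1 - f gives the other side.\<close>

lemma expectation_binomial_poisson:
  assumes "\<beta> > 0" "real m \<ge> 2 * \<beta>" "\<And>k. 0 \<le> f k" "\<And>k. f k \<le> 1"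
  shows "\<bar>measure_pmf.expectation (binomial_pmf m (\<beta> / real m)) f -
    measure_pmf.expectation (poisson_pmf \<beta>) f\<bar> \<le> exp (2 * \<beta>\<^sup>2 / real m) - 1"
proof -
  have int: "integrable (measure_pmf M) f" for M :: "nat pmf"
    using assms by (intro measure_pmf.integrable_const_bound[where B = 1]) auto
  have compl: "measure_pmf.expectation M (\<lambda>k. 1 - f k) = 1 - measure_pmf.expectation M f" for M
    by (subst Bochner_Integration.integral_diff) (auto simp: int)
  have "1 - measure_pmf.expectation (binomial_pmf m (\<beta> / real m)) f -
      (1 - measure_pmf.expectation (poisson_pmf \<beta>) f) \<le> exp (2 * \<beta>\<^sup>2 / real m) - 1"
    unfolding compl[symmetric] by (rule expectation_binomial_poisson_le) (use assms in auto)
  moreover have "measure_pmf.expectation (binomial_pmf m (\<beta> / real m)) f -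
      measure_pmf.expectation (poisson_pmf \<beta>) f \<le> exp (2 * \<beta>\<^sup>2 / real m) - 1"
    by (rule expectation_binomial_poisson_le) (use assms in auto)
  ultimately show ?thesis by linarith
qed


section \<open>Stationarity of the mixed Poisson law\<close>

text \<open>A closed formula in l on the whole real line, so that it can be differentiated and
  integrated in the parameter.\<close>

definition poisson_weight :: "nat \<Rightarrow> real \<Rightarrow> real" where
  "poisson_weight k l = l ^ k / fact k * exp (- l)"

lemma poisson_weight_eq_pmf: "l > 0 \<Longrightarrow> poisson_weight k l = pmf (poisson_pmf l) k"
  by (simp add: poisson_weight_def)

lemma poisson_weight_bounds:
  assumes "l > 0"
  shows "0 \<le> poisson_weight k l" "poisson_weight k l \<le> 1"
  using assms by (simp_all only: poisson_weight_eq_pmf pmf_nonneg pmf_le_1)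

lemma poisson_weight_Suc: "real (Suc k) * poisson_weight (Suc k) l = l * poisson_weight k l"
  by (simp add: poisson_weight_def del: of_nat_Suc)

text \<open>This is the forward equation of the Poisson process: a change of the parameter acts on
  the weights like the gain of one edge.\<close>

lemma poisson_weight_deriv:
  "(poisson_weight k has_real_derivative
     ((if k = 0 then 0 else poisson_weight (k - 1) l) - poisson_weight k l)) (at l)"
proof (cases k)
  case 0
  show ?thesis unfolding poisson_weight_def 0
    by (auto intro!: derivative_eq_intros)
next
  case (Suc j)
  have "((\<lambda>l. l ^ Suc j / fact (Suc j) * exp (- l)) has_real_derivative
      (real (Suc j) * l ^ (Suc j - Suc 0) / fact (Suc j)) * exp (- l) +
      (exp (- l) * - 1) * (l ^ Suc j / fact (Suc j))) (at l)"
    by (intro DERIV_mult DERIV_cdivide DERIV_pow DERIV_chain2[OF DERIV_exp DERIV_minus[OF DERIV_ident]])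
  also have "(real (Suc j) * l ^ (Suc j - Suc 0) / fact (Suc j)) * exp (- l) +
      (exp (- l) * - 1) * (l ^ Suc j / fact (Suc j)) = poisson_weight j l - poisson_weight (Suc j) l"
    by (simp add: poisson_weight_def del: of_nat_Suc)
  finally show ?thesis by (simp add: poisson_weight_def[abs_def] Suc)
qed

text \<open>Two index shifts turn k * (k - 1) into l^2. This moment is the one that dominates the
  effect of cutting removal probabilities off at 1.\<close>

lemma poisson_weight_factorial_moment:
  assumes "l > 0"
  shows "(\<Sum>k<K. real k * (real k - 1) * poisson_weight k l) \<le> l\<^sup>2"
proof -
  have "(\<Sum>k<K. real k * (real k - 1) * poisson_weight k l) \<le>
      (\<Sum>k<Suc (Suc K). real k * (real k - 1) * poisson_weight k l)"
  proof (rule sum_mono2)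
    fix k show "0 \<le> real k * (real k - 1) * poisson_weight k l"
      using poisson_weight_bounds[OF assms, of k] by (cases k) auto
  qed auto
  also have "\<dots> = (\<Sum>k<K. real (Suc (Suc k)) * (real (Suc (Suc k)) - 1) * poisson_weight (Suc (Suc k)) l)"
    by (subst sum.lessThan_Suc_shift, subst sum.lessThan_Suc_shift) simp
  also have "\<dots> = (\<Sum>k<K. l\<^sup>2 * poisson_weight k l)"
  proof (rule sum.cong[OF refl])
    fix k
    have "real (Suc (Suc k)) * (real (Suc (Suc k)) - 1) * poisson_weight (Suc (Suc k)) l =
        real (Suc k) * (real (Suc (Suc k)) * poisson_weight (Suc (Suc k)) l)" by simp
    also have "\<dots> = l * (real (Suc k) * poisson_weight (Suc k) l)"
      by (simp only: poisson_weight_Suc[of "Suc k"] mult.left_commute)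
    also have "\<dots> = l\<^sup>2 * poisson_weight k l"
      unfolding poisson_weight_Suc by (simp add: power2_eq_square)
    finally show "real (Suc (Suc k)) * (real (Suc (Suc k)) - 1) * poisson_weight (Suc (Suc k)) l =
        l\<^sup>2 * poisson_weight k l" .
  qed
  also have "\<dots> = l\<^sup>2 * measure (measure_pmf (poisson_pmf l)) {..<K}"
    using assms by (simp add: sum_distrib_left[symmetric] measure_measure_pmf_finite poisson_weight_eq_pmf
      del: pmf_poisson)
  also have "\<dots> \<le> l\<^sup>2 * 1" by (intro mult_left_mono) auto
  finally show ?thesis by simp
qed

context drgvr_params
begin

section \<open>The limit rate and the weights of the limit law\<close>

abbreviation rate :: "real \<Rightarrow> real" where "rate \<equiv> limit_rate \<beta> \<epsilon>"

definition r :: real where "r = p / (2 * \<epsilon>)"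

definition limit_weight :: "nat \<Rightarrow> real" where
  "limit_weight k = measure (limit_degree \<beta> \<epsilon>) {k}"

text \<open>The reset probability is p / (2 * \<epsilon> * n) = r / n, so r >= 1 is what makes the
  contraction factor at most 1 - 1/n. It also keeps the density r * a powr (r - 1) bounded.\<close>

lemma r_bounds: "r \<ge> 1" "2 * \<epsilon> * r = p"
  using p_bounds eps_pos by (auto simp: r_def)

lemma rate_pos: "0 < a \<Longrightarrow> a < 1 \<Longrightarrow> rate a > 0"
  using limit_rate_pos beta_pos eps_pos eps_le by blast

text \<open>The point a = 1 is age 0, so the boundary term of the integrated equation is the law
  \<open>Po(\<beta>)\<close> of a fresh vertex.\<close>

lemma rate_1: "rate 1 = \<beta>"
proof (cases "p = 1")
  case True
  then show ?thesis by (simp add: limit_rate_def p_def)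
next
  case False
  have "1 - (2 * p - 1) / p = (1 - p) / p" using p_bounds(1) by (simp add: field_simps)
  then show ?thesis using False p_bounds(1) by (simp add: limit_rate_def p_def[symmetric])
qed

text \<open>The bound is the rest point of the linear equation for the expected degree. For p = 1
  edges are never lost and the rate grows like - ln a.\<close>

lemma rate_le:
  assumes "p \<noteq> 1"
  shows "rate a \<le> \<beta> * p / (1 - p)"
proof -
  have "0 \<le> (2 * p - 1) / p * a powr ((1 - p) / (2 * \<epsilon>))"
    using p_bounds eps_pos by (intro mult_nonneg_nonneg divide_nonneg_nonneg) auto
  then have "\<beta> * p / (1 - p) * (1 - (2 * p - 1) / p * a powr ((1 - p) / (2 * \<epsilon>))) \<le> \<beta> * p / (1 - p) * 1"
    using p_bounds beta_pos by (intro mult_left_mono) auto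
  then show ?thesis using assms by (simp add: limit_rate_def p_def[symmetric])
qed

text \<open>In the time \<open>t = - ln a / (2 * \<epsilon>)\<close> since the arrival of the root, the expected degree solves
  the linear equation \<open>\<lambda>' = p * \<beta> - (1 - p) * \<lambda>\<close>.\<close>

lemma rate_deriv:
  assumes "a > 0"
  shows "(rate has_real_derivative - (p * \<beta> - (1 - p) * rate a) / (2 * \<epsilon> * a)) (at a)"
proof (cases "p = 1")
  case True
  then have "\<epsilon> = 1 / 2" by (simp add: p_def)
  have "((\<lambda>a. \<beta> * (1 - ln a)) has_real_derivative \<beta> * (0 - 1 / a)) (at a)"
    using assms by (auto intro!: derivative_eq_intros)
  moreover have "rate = (\<lambda>a. \<beta> * (1 - ln a))" using True by (auto simp: limit_rate_def p_def)
  moreover have "\<beta> * (0 - 1 / a) = - (p * \<beta> - (1 - p) * rate a) / (2 * \<epsilon> * a)"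
    by (simp add: True \<open>\<epsilon> = 1 / 2\<close>)
  ultimately show ?thesis by simp
next
  case False
  define g where "g = (1 - p) / (2 * \<epsilon>)"
  have rate: "rate = (\<lambda>a. \<beta> * p / (1 - p) * (1 - (2 * p - 1) / p * a powr g))"
    using False by (intro ext) (simp add: limit_rate_def p_def[symmetric] g_def)
  have "((\<lambda>a. \<beta> * p / (1 - p) * (1 - (2 * p - 1) / p * a powr g)) has_real_derivative
      \<beta> * p / (1 - p) * (0 - (2 * p - 1) / p * (g * a powr (g - 1)))) (at a)"
    by (intro DERIV_cmult DERIV_diff DERIV_const has_real_derivative_powr assms)
  also have "\<beta> * p / (1 - p) * (0 - (2 * p - 1) / p * (g * a powr (g - 1))) =
      - (\<beta> * (2 * p - 1) * a powr g) / (2 * \<epsilon> * a)"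
  proof -
    have powr: "a powr (g - 1) = a powr g / a" using assms by (simp add: powr_diff)
    have g: "1 - p = 2 * \<epsilon> * g" "g \<noteq> 0" using False eps_pos by (auto simp: g_def)
    show ?thesis
      unfolding powr g(1) using assms eps_pos p_bounds(1) g(2) by simp
  qed
  also have "\<beta> * (2 * p - 1) * a powr g = p * \<beta> - (1 - p) * rate a"
    using False p_bounds(1) by (simp add: rate field_simps)
  finally show ?thesis by (simp add: rate)
qed

text \<open>\<open>Beta(r, 1)\<close> has density r * a powr (r - 1) because Beta r 1 = 1 / r. The
  gauge integral over the closed interval is the form to which the fundamental theorem of calculus
  applies.\<close>

lemma limit_weight_has_integral:
  "((\<lambda>a. r * a powr (r - 1) * poisson_weight k (rate a)) has_integral limit_weight k) {0..1}"
proof -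
  interpret L: prob_space "limit_degree \<beta> \<epsilon>"
    using beta_pos eps_pos eps_le by (rule prob_space_limit_degree)
  define f where "f = (\<lambda>a. if a \<in> {0<..<1} then r * a powr (r - 1) * poisson_weight k (rate a) else 0)"
  have "Gamma (r + 1) = r * Gamma r"
    using r_bounds by (intro Gamma_plus1) (auto elim!: nonpos_Ints_cases)
  moreover have "Gamma r > 0" using r_bounds by (intro Gamma_real_pos) auto
  ultimately have Beta: "Beta r 1 = 1 / r" by (simp add: Beta_def)
  have [measurable]: "rate \<in> borel_measurable borel"
    unfolding limit_rate_def Let_def by measurable
  have meas: "(\<lambda>a. poisson_weight k (rate a)) \<in> borel_measurable borel"
    unfolding poisson_weight_def by measurable
  have f_meas: "f \<in> borel_measurable borel"
    unfolding f_def using meas by measurable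
  have f_nonneg: "0 \<le> f a" for a
    using r_bounds rate_pos poisson_weight_bounds by (auto simp: f_def)
  have "ennreal (limit_weight k) = emeasure (limit_degree \<beta> \<epsilon>) {k}"
    by (simp add: limit_weight_def L.emeasure_eq_measure)
  also have "\<dots> = (\<integral>\<^sup>+a. emeasure (measure_pmf (poisson_pmf (rate a))) {k} \<partial>beta_distribution r 1)"
    unfolding r_def using beta_pos eps_pos eps_le by (simp add: emeasure_limit_degree p_def)
  also have "\<dots> = (\<integral>\<^sup>+a. ennreal (poisson_weight k (rate a)) \<partial>beta_distribution r 1)"
    using rate_pos
    by (intro nn_integral_cong)
      (auto simp: beta_distribution_def space_restrict_space emeasure_pmf_single poisson_weight_eq_pmf
        simp del: pmf_poisson)
  also have "\<dots> = (\<integral>\<^sup>+a. ennreal (a powr (r - 1) * (1 - a) powr (1 - 1) / Beta r 1) *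
      ennreal (poisson_weight k (rate a)) \<partial>restrict_space lborel {0<..<1})"
    unfolding beta_distribution_def using meas
    by (subst nn_integral_density) (auto intro!: measurable_restrict_space1)
  also have "\<dots> = (\<integral>\<^sup>+a. ennreal (a powr (r - 1) * (1 - a) powr (1 - 1) / Beta r 1) *
      ennreal (poisson_weight k (rate a)) * indicator {0<..<1} a \<partial>lborel)"
    by (subst nn_integral_restrict_space) auto
  also have "\<dots> = (\<integral>\<^sup>+a. ennreal (f a) \<partial>lborel)"
  proof (intro nn_integral_cong)
    fix a :: real
    show "ennreal (a powr (r - 1) * (1 - a) powr (1 - 1) / Beta r 1) *
      ennreal (poisson_weight k (rate a)) * indicator {0<..<1} a = ennreal (f a)"
      using r_bounds rate_pos[of a] poisson_weight_bounds[of "rate a" k]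
      by (auto simp: f_def Beta ennreal_mult[symmetric] indicator_def mult_ac)
  qed
  finally have "(\<integral>\<^sup>+a. ennreal (f a) \<partial>lborel) = ennreal (limit_weight k)" by simp
  then have "(f has_integral limit_weight k) UNIV"
    using f_meas f_nonneg by (intro nn_integral_has_integral) (auto simp: limit_weight_def)
  then have "((\<lambda>a. r * a powr (r - 1) * poisson_weight k (rate a)) has_integral limit_weight k) {0<..<1}"
    unfolding f_def by (subst (asm) has_integral_restrict_UNIV)
  then show ?thesis by (simp add: has_integral_Icc_iff_Ioo)
qed

lemma limit_weight_nonneg: "0 \<le> limit_weight k"
  by (simp add: limit_weight_def)

lemma sum_limit_weight:
  assumes "finite A"
  shows "(\<Sum>k\<in>A. limit_weight k) = measure (limit_degree \<beta> \<epsilon>) A"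
proof -
  interpret L: prob_space "limit_degree \<beta> \<epsilon>"
    using beta_pos eps_pos eps_le by (rule prob_space_limit_degree)
  show ?thesis
    unfolding limit_weight_def using assms sets_limit_degree[OF beta_pos eps_pos eps_le]
    by (intro L.finite_measure_eq_sum_singleton[symmetric]) auto
qed

lemma sum_limit_weight_le_1:
  assumes "finite A"
  shows "(\<Sum>k\<in>A. limit_weight k) \<le> 1"
proof -
  interpret L: prob_space "limit_degree \<beta> \<epsilon>"
    using beta_pos eps_pos eps_le by (rule prob_space_limit_degree)
  show ?thesis using assms by (simp add: sum_limit_weight)
qed

text \<open>The division by zero for \<open>p = 1\<close> is harmless, since both sides then vanish.\<close>

lemma limit_weight_factorial_moment:
  "(1 - p) * (\<Sum>k<K. real k * (real k - 1) * limit_weight k) \<le> (1 - p) * (r * (\<beta> * p / (1 - p))\<^sup>2)"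
proof (cases "p = 1")
  case False
  define w where "w = (\<lambda>k a. r * a powr (r - 1) * poisson_weight k (rate a))"
  have "((\<lambda>a. \<Sum>k<K. real k * (real k - 1) * w k a) has_integral
      (\<Sum>k<K. real k * (real k - 1) * limit_weight k)) {0<..<1}"
    using limit_weight_has_integral unfolding w_def
    by (intro has_integral_sum has_integral_mult_right) (auto simp: has_integral_Icc_iff_Ioo)
  moreover have "((\<lambda>_. r * (\<beta> * p / (1 - p))\<^sup>2) has_integral r * (\<beta> * p / (1 - p))\<^sup>2) {0<..<1::real}"
    using has_integral_const_real[of "r * (\<beta> * p / (1 - p))\<^sup>2" 0 1]
    by (simp add: has_integral_Icc_iff_Ioo)
  moreover have "(\<Sum>k<K. real k * (real k - 1) * w k a) \<le> r * (\<beta> * p / (1 - p))\<^sup>2"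
    if a: "a \<in> {0<..<1}" for a
  proof -
    have pos: "rate a > 0" using a rate_pos by auto
    have "(\<Sum>k<K. real k * (real k - 1) * w k a) =
        r * a powr (r - 1) * (\<Sum>k<K. real k * (real k - 1) * poisson_weight k (rate a))"
      by (simp add: w_def sum_distrib_left mult_ac)
    also have "\<dots> \<le> r * a powr (r - 1) * (rate a)\<^sup>2"
      using r_bounds by (intro mult_left_mono poisson_weight_factorial_moment pos) auto
    also have "\<dots> \<le> r * 1 * (\<beta> * p / (1 - p))\<^sup>2"
      using r_bounds a pos rate_le[OF False, of a]
      by (intro mult_mono power_mono powr_le1 mult_nonneg_nonneg) auto
    finally show ?thesis by simp
  qed
  ultimately have "(\<Sum>k<K. real k * (real k - 1) * limit_weight k) \<le> r * (\<beta> * p / (1 - p))\<^sup>2"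
    by (rule has_integral_le)
  then show ?thesis using p_bounds by (intro mult_left_mono) auto
qed simp

text \<open>Balance of the degree \<open>k\<close>: in the limit a vertex is replaced by a fresh one at rate \<open>p\<close>, gains an
  edge at rate \<open>p * \<beta>\<close> and loses each edge at rate \<open>1 - p\<close>.\<close>

lemma limit_weight_stationary:
  "p * poisson_weight k \<beta> - p * limit_weight k
    + p * \<beta> * ((if k = 0 then 0 else limit_weight (k - 1)) - limit_weight k)
    + (1 - p) * (real (Suc k) * limit_weight (Suc k) - real k * limit_weight k) = 0"
proof -
  \<comment> \<open>With a = exp (- 2 * \<epsilon> * t), the factor a powr r is exp (- p * t), the
    probability of no reset up to age t. The integral of the derivative of G thus compares age 0
    with infinite age.\<close>
  define G where "G = (\<lambda>a. a powr r * poisson_weight k (rate a))"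
  define w where "w = (\<lambda>k a. r * a powr (r - 1) * poisson_weight k (rate a))"
  define D where "D = (\<lambda>a. (p * w k a
      - p * \<beta> * ((if k = 0 then 0 else w (k - 1) a) - w k a)
      - (1 - p) * (real (Suc k) * w (Suc k) a - real k * w k a)) / p)"
  have G_deriv: "(G has_real_derivative D a) (at a)" if a: "a > 0" for a
  proof -
    define u where "u = poisson_weight k (rate a)"
    define v where "v = (if k = 0 then 0 else poisson_weight (k - 1) (rate a))"
    define z where "z = poisson_weight (Suc k) (rate a)"
    \<comment> \<open>These two identities trade the factor \<open>rate a\<close>, which varies with
      a, for the constants k + 1 and k; only then does D integrate to a linear combination of limit
      weights.\<close>
    have uz: "real (Suc k) * z = rate a * u" unfolding u_def z_def by (rule poisson_weight_Suc)
    have uv: "real k * u = rate a * v"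
      using poisson_weight_Suc[of "k - 1" "rate a"] by (cases k) (auto simp: u_def v_def)
    have rp: "y / (2 * \<epsilon>) = r * y / p" for y using p_bounds(1) by (simp add: r_def)
    have ar: "a powr r = a * a powr (r - 1)" using a by (simp add: powr_diff)
    have "(G has_real_derivative (r * a powr (r - 1)) * u +
        ((v - u) * (- (p * \<beta> - (1 - p) * rate a) / (2 * \<epsilon> * a))) * a powr r) (at a)"
      unfolding G_def u_def v_def
      by (intro DERIV_mult DERIV_chain2[OF poisson_weight_deriv rate_deriv] has_real_derivative_powr a)
    also have "(r * a powr (r - 1)) * u +
        ((v - u) * (- (p * \<beta> - (1 - p) * rate a) / (2 * \<epsilon> * a))) * a powr r =
        r * a powr (r - 1) * (p * u - (p * \<beta> - (1 - p) * rate a) * (v - u)) / p"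
    proof -
      have "((v - u) * (- (p * \<beta> - (1 - p) * rate a) / (2 * \<epsilon> * a))) * a powr r =
          - ((p * \<beta> - (1 - p) * rate a) * (v - u)) * a powr (r - 1) / (2 * \<epsilon>)"
      proof -
        have "(v - u) * (- c / (2 * \<epsilon> * a)) * (a * w) = - (c * (v - u)) * w / (2 * \<epsilon>)" for c w
          using a eps_pos by (simp add: field_simps)
        then show ?thesis unfolding ar .
      qed
      also have "\<dots> = r * (- ((p * \<beta> - (1 - p) * rate a) * (v - u)) * a powr (r - 1)) / p"
        using rp .
      finally show ?thesis using p_bounds(1) by (simp add: field_simps)
    qed
    also have "p * u - (p * \<beta> - (1 - p) * rate a) * (v - u) =
        p * u - p * \<beta> * (v - u) - (1 - p) * (real (Suc k) * z - real k * u)"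
      unfolding uz uv by (simp add: algebra_simps)
    also have "r * a powr (r - 1) * (p * u - p * \<beta> * (v - u) - (1 - p) * (real (Suc k) * z - real k * u)) / p
        = D a"
      by (simp add: D_def w_def u_def v_def z_def algebra_simps)
    finally show ?thesis .
  qed
  have "(D has_integral G 1 - G 0) {0..1}"
  proof (rule fundamental_theorem_of_calculus_interior)
    show "(G has_vector_derivative D a) (at a)" if "a \<in> {0<..<1}" for a
      using G_deriv[of a] that by (simp add: has_real_derivative_iff_has_vector_derivative)
    show "continuous_on {0..1} G"
      unfolding continuous_on_eq_continuous_within
    proof
      fix a :: real assume a: "a \<in> {0..1}"
      show "continuous (at a within {0..1}) G"
      proof (cases "a = 0")
        case False
        then have "isCont G a" using G_deriv[of a] a by (intro DERIV_isCont) auto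
        then show ?thesis by (rule continuous_at_imp_continuous_at_within)
      next
        \<comment> \<open>At 0 the rate has no finite limit if p = 1, so the Poisson weight is only
          bounded by 1 and a powr r forces the limit 0.\<close>
        case True
        have "((\<lambda>a. a powr r) \<longlongrightarrow> 0 powr r) (at_right 0)"
          using r_bounds by real_asymp
        then have lim: "((\<lambda>a. a powr r) \<longlongrightarrow> 0) (at_right 0)" using r_bounds by simp
        have ev: "\<forall>\<^sub>F a in at_right (0::real). 0 < a \<and> a < 1"
          by (auto simp: eventually_at_right_field intro: exI[of _ 1])
        have "(G \<longlongrightarrow> 0) (at_right 0)"
          unfolding G_def
        proof (rule tendsto_sandwich[OF _ _ tendsto_const lim])
          show "\<forall>\<^sub>F a in at_right 0. 0 \<le> a powr r * poisson_weight k (rate a)"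
            using ev by eventually_elim (use rate_pos poisson_weight_bounds in auto)
          show "\<forall>\<^sub>F a in at_right 0. a powr r * poisson_weight k (rate a) \<le> a powr r"
            using ev by eventually_elim (use rate_pos poisson_weight_bounds in \<open>auto intro: mult_left_le\<close>)
        qed
        moreover have "G 0 = 0" using r_bounds by (simp add: G_def)
        ultimately show ?thesis
          unfolding True continuous_within at_within_Icc_at_right[OF zero_less_one] by simp
      qed
    qed
  qed simp
  moreover have "G 1 - G 0 = poisson_weight k \<beta>"
    using r_bounds by (simp add: G_def rate_1)
  moreover have "(D has_integral (p * limit_weight k
      - p * \<beta> * ((if k = 0 then 0 else limit_weight (k - 1)) - limit_weight k)
      - (1 - p) * (real (Suc k) * limit_weight (Suc k) - real k * limit_weight k)) / p) {0..1}"
  proof -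
    have *: "(w j has_integral limit_weight j) {0..1}" for j
      unfolding w_def by (rule limit_weight_has_integral)
    have "((\<lambda>a. if k = 0 then 0 else w (k - 1) a) has_integral
        (if k = 0 then 0 else limit_weight (k - 1))) {0..1}"
      using * by auto
    then show ?thesis unfolding D_def
      by (intro has_integral_divide has_integral_diff has_integral_mult_right *)
  qed
  ultimately have "poisson_weight k \<beta> = (p * limit_weight k
      - p * \<beta> * ((if k = 0 then 0 else limit_weight (k - 1)) - limit_weight k)
      - (1 - p) * (real (Suc k) * limit_weight (Suc k) - real k * limit_weight k)) / p"
    by (metis has_integral_unique)
  then show ?thesis using p_bounds(1) by (simp add: field_simps)
qed


section \<open>Contraction\<close>

text \<open>The part of a step of the root degree in which the root is not replaced by a fresh vertex, with
  the number of vertices frozen at \<open>1 / s\<close>. The minimum keeps the kernel positive.\<close>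

definition surviving_step :: "real \<Rightarrow> (nat \<Rightarrow> real) \<Rightarrow> nat \<Rightarrow> real" where
  "surviving_step s f d = p * (s * \<beta> * f (Suc d) + (1 - s - s * \<beta>) * f d) +
     (1 - p) * (min 1 (real d * s) * f (d - 1) + (1 - min 1 (real d * s)) * f d)"

text \<open>The coefficients add up to 1 - p * s, the missing mass being the reset, and s * (1 +
  \<beta>) <= 1 makes them nonnegative. Divided by 1 - p * s, the step therefore preserves
  [0, 1]-valued test functions.\<close>

lemma surviving_step_bounds:
  assumes "0 \<le> s" "s * (1 + \<beta>) \<le> 1" "\<And>k. 0 \<le> f k" "\<And>k. f k \<le> 1"
  shows "0 \<le> surviving_step s f d" "surviving_step s f d \<le> 1 - p * s"
proof -
  define c where "c = min 1 (real d * s)"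
  have c: "0 \<le> c" "c \<le> 1" using assms by (auto simp: c_def)
  have s: "0 \<le> s * \<beta>" "0 \<le> 1 - s - s * \<beta>" using assms beta_pos by (auto simp: algebra_simps)
  have p: "0 \<le> p" "0 \<le> 1 - p" using p_bounds by auto
  show "0 \<le> surviving_step s f d"
    unfolding surviving_step_def c_def[symmetric] using c s p assms beta_pos
    by (intro add_nonneg_nonneg mult_nonneg_nonneg) auto
  have "surviving_step s f d \<le> p * (s * \<beta> * 1 + (1 - s - s * \<beta>) * 1) + (1 - p) * (c * 1 + (1 - c) * 1)"
    unfolding surviving_step_def c_def[symmetric] using c s p assms
    by (intro add_mono mult_left_mono) auto
  also have "\<dots> = 1 - p * s" by (simp add: algebra_simps)
  finally show "surviving_step s f d \<le> 1 - p * s" .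
qed

lemma poisson_expectation_finite:
  assumes "\<And>k. k \<ge> K \<Longrightarrow> f k = 0"
  shows "measure_pmf.expectation (poisson_pmf \<beta>) f = (\<Sum>k<K. poisson_weight k \<beta> * f k)"
  using assms beta_pos
  by (subst integral_measure_pmf_real[of "{..<K}"])
    (auto simp: poisson_weight_def not_less[symmetric] mult.commute intro!: sum.cong)

text \<open>The truncation of the removal probability \<open>k * s\<close> at 1 is the only source of the error.\<close>

lemma limit_weight_almost_invariant:
  assumes s: "0 \<le> s" "s \<le> 1" and f: "\<And>k. 0 \<le> f k" "\<And>k. f k \<le> 1" "\<And>k. k \<ge> K \<Longrightarrow> f k = 0"
  shows "\<bar>p * s * measure_pmf.expectation (poisson_pmf \<beta>) f
      + (\<Sum>k<Suc K. limit_weight k * surviving_step s f k) - (\<Sum>k<K. limit_weight k * f k)\<bar>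
    \<le> s\<^sup>2 * ((1 - p) * (r * (\<beta> * p / (1 - p))\<^sup>2))"
proof -
  define x where "x = limit_weight"
  define xprev where "xprev = (\<lambda>k. if k = 0 then 0 else x (k - 1))"
  define c where "c = (\<lambda>k. min 1 (real k * s))"
  have surviving: "surviving_step s f k = p * (s * \<beta> * f (Suc k) + (1 - s - s * \<beta>) * f k) +
     (1 - p) * (c k * f (k - 1) + (1 - c k) * f k)" for k
    by (simp add: surviving_step_def c_def)
  \<comment> \<open>T tests the balance equations against f. Summation by parts below moves the
    shifts from the limit weights to f.\<close>
  define T where "T = (\<Sum>k<K. f k * (p * poisson_weight k \<beta> - p * x k + p * \<beta> * (xprev k - x k)
    + (1 - p) * (real (Suc k) * x (Suc k) - real k * x k)))"
  have T: "T = 0"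
    unfolding T_def xprev_def x_def
    by (intro sum.neutral ballI) (simp only: limit_weight_stationary mult_zero_right)
  have shift1: "(\<Sum>k<K. f k * xprev k) = (\<Sum>k<Suc K. x k * f (Suc k))"
  proof -
    have "(\<Sum>k<K. f k * xprev k) = (\<Sum>k<Suc K. f k * xprev k)" by (simp add: f(3))
    also have "\<dots> = (\<Sum>k<K. f (Suc k) * x k)" by (subst sum.lessThan_Suc_shift) (simp add: xprev_def)
    also have "\<dots> = (\<Sum>k<Suc K. x k * f (Suc k))" by (simp add: f(3) mult.commute)
    finally show ?thesis .
  qed
  \<comment> \<open>The term k = K still meets f (K - 1), which is why the sums over
    \<open>surviving_step\<close> run to Suc K.\<close>
  have shift2: "(\<Sum>k<K. f k * (real (Suc k) * x (Suc k))) = (\<Sum>k<Suc K. real k * x k * f (k - 1))"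
    by (subst sum.lessThan_Suc_shift) (simp add: mult_ac)
  have ext: "(\<Sum>k<K. f k * h k) = (\<Sum>k<Suc K. f k * h k)" for h :: "nat \<Rightarrow> real"
    by (simp add: f(3))
  have "T = p * (\<Sum>k<K. poisson_weight k \<beta> * f k) - p * (\<Sum>k<K. f k * x k)
      + p * \<beta> * (\<Sum>k<K. f k * xprev k) - p * \<beta> * (\<Sum>k<K. f k * x k)
      + (1 - p) * (\<Sum>k<K. f k * (real (Suc k) * x (Suc k))) - (1 - p) * (\<Sum>k<K. f k * (real k * x k))"
    unfolding T_def
    by (simp add: sum_distrib_left sum.distrib[symmetric] sum_subtractf[symmetric] algebra_simps)
  also have "\<dots> = p * measure_pmf.expectation (poisson_pmf \<beta>) f +
      (\<Sum>k<Suc K. x k * (- p * f k + p * \<beta> * (f (Suc k) - f k) + (1 - p) * real k * (f (k - 1) - f k)))"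
    unfolding shift1 shift2 poisson_expectation_finite[where f = f and K = K, OF f(3), simplified] ext[of x] ext[of "\<lambda>k. real k * x k"]
    by (simp add: sum_distrib_left sum.distrib sum_subtractf algebra_simps del: sum.lessThan_Suc)
  finally have balance: "p * measure_pmf.expectation (poisson_pmf \<beta>) f = - (\<Sum>k<Suc K. x k *
      (- p * f k + p * \<beta> * (f (Suc k) - f k) + (1 - p) * real k * (f (k - 1) - f k)))"
    using T by simp
  have "p * s * measure_pmf.expectation (poisson_pmf \<beta>) f
      + (\<Sum>k<Suc K. x k * surviving_step s f k) - (\<Sum>k<K. x k * f k) =
      s * (p * measure_pmf.expectation (poisson_pmf \<beta>) f)
      + (\<Sum>k<Suc K. x k * surviving_step s f k) - (\<Sum>k<Suc K. x k * f k)"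
    by (simp add: f(3))
  also have "\<dots> = (\<Sum>k<Suc K. x k * ((1 - p) * ((real k * s - c k) * (f k - f (k - 1)))))"
    unfolding balance sum_negf[symmetric] sum_distrib_left sum.distrib[symmetric] sum_subtractf[symmetric]
    by (intro sum.cong refl) (simp add: surviving algebra_simps)
  finally have eq: "p * s * measure_pmf.expectation (poisson_pmf \<beta>) f
      + (\<Sum>k<Suc K. x k * surviving_step s f k) - (\<Sum>k<K. x k * f k) =
      (\<Sum>k<Suc K. x k * ((1 - p) * ((real k * s - c k) * (f k - f (k - 1)))))" .
  have "\<bar>\<Sum>k<Suc K. x k * ((1 - p) * ((real k * s - c k) * (f k - f (k - 1))))\<bar> \<le>
      (\<Sum>k<Suc K. x k * ((1 - p) * (s\<^sup>2 * (real k * (real k - 1)) * 1)))"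
  proof (rule order_trans[OF sum_abs], rule sum_mono)
    fix k
    have "0 \<le> real k * s - c k" by (simp add: c_def)
    \<comment> \<open>The excess vanishes unless k * s > 1, and there multiplying by k * s only
      enlarges the bound s * (k - 1). This makes the error quadratic in s.\<close>
    moreover have "real k * s - c k \<le> s\<^sup>2 * (real k * (real k - 1))"
    proof (cases "real k * s \<le> 1")
      case True
      then show ?thesis using s by (cases k) (auto simp: c_def)
    next
      case False
      then have "k > 0" by (cases k) auto
      have "real k * s - 1 \<le> real k * s - s" using s by simp
      also have "\<dots> = 1 * (s * (real k - 1))" by (simp add: algebra_simps)
      also have "\<dots> \<le> (real k * s) * (s * (real k - 1))"
        using False s \<open>k > 0\<close> by (intro mult_right_mono) auto
      finally show ?thesis using False by (simp add: c_def power2_eq_square mult_ac)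
    qed
    moreover have "\<bar>f k - f (k - 1)\<bar> \<le> 1" using f(1,2)[of k] f(1,2)[of "k - 1"] by linarith
    ultimately show "\<bar>x k * ((1 - p) * ((real k * s - c k) * (f k - f (k - 1))))\<bar> \<le>
        x k * ((1 - p) * (s\<^sup>2 * (real k * (real k - 1)) * 1))"
      unfolding abs_mult using limit_weight_nonneg p_bounds
      by (simp only: x_def abs_of_nonneg limit_weight_nonneg diff_ge_0_iff_ge)
        (intro mult_left_mono mult_mono; simp add: limit_weight_nonneg)
  qed
  also have "\<dots> = s\<^sup>2 * ((1 - p) * (\<Sum>k<Suc K. real k * (real k - 1) * limit_weight k))"
    unfolding sum_distrib_left x_def by (intro sum.cong refl) (simp add: mult_ac)
  also have "\<dots> \<le> s\<^sup>2 * ((1 - p) * (r * (\<beta> * p / (1 - p))\<^sup>2))"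
    by (intro mult_left_mono limit_weight_factorial_moment) simp
  finally show ?thesis using eq by (simp add: x_def)
qed

text \<open>The true rates 1 / (m + 1) and 1 / (m - 1) differ from s by |1/m - s| up to O(1/m^2),
  and replacing the binomial by the Poisson law costs O(1/m) on an event of probability 1 / (m + 1).
  The removal term is multiplied by d, hence the factor 1 + d.\<close>

lemma step_compare:
  assumes m: "real m \<ge> 2" "real m \<ge> 2 * \<beta>" "real m \<ge> 2 * \<beta>\<^sup>2" and d: "d \<le> m - 1"
    and s: "0 \<le> s" and f: "\<And>k. 0 \<le> f k" "\<And>k. f k \<le> 1"
  shows "\<bar>p * measure_pmf.expectation (arrive \<beta> (m, d)) (\<lambda>x. f (snd x))
      + (1 - p) * measure_pmf.expectation (depart (m, d)) (\<lambda>x. f (snd x))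
      - (p * s * measure_pmf.expectation (poisson_pmf \<beta>) f + surviving_step s f d)\<bar>
    \<le> (1 + real d) * ((4 * \<beta>\<^sup>2 + 2 * \<beta> + 2) * (\<bar>1 / real m - s\<bar> + 1 / (real m)\<^sup>2))"
proof -
  define e where "e = \<bar>1 / real m - s\<bar>"
  define i where "i = 1 / (real m)\<^sup>2"
  define u where "u = 1 / real (Suc m)"
  define v where "v = 1 / real (m - 1)"
  define B where "B = measure_pmf.expectation (binomial_pmf m (\<beta> / real m)) f"
  define P where "P = measure_pmf.expectation (poisson_pmf \<beta>) f"
  define c where "c = min 1 (real d * s)"
  have m0: "real m > 0" using m by linarith
  have q: "link_prob \<beta> m = \<beta> / real m"
    using m beta_pos m0 by (simp add: link_prob_def)
  have "i \<ge> 0" by (simp add: i_def)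
  have "e \<ge> 0" by (simp add: e_def)
  have u: "0 \<le> u" "u \<le> 1 / real m" "1 / real m - u \<le> i"
  proof -
    have "1 / real m - u = 1 / (real m * (real m + 1))" using m0 by (simp add: u_def field_simps)
    also have "\<dots> \<le> i" unfolding i_def power2_eq_square using m0 by (intro divide_left_mono mult_left_mono) auto
    finally show "1 / real m - u \<le> i" .
  qed (use m0 in \<open>auto simp: u_def field_simps\<close>)
  have us: "\<bar>u - s\<bar> \<le> e + i" using u by (simp add: e_def)
  have v: "1 / real m \<le> v" "v - 1 / real m \<le> 2 * i"
  proof -
    have r: "real (m - 1) = real m - 1" using m by (simp add: of_nat_diff)
    have "v - 1 / real m = 1 / (real m * (real m - 1))" using m by (simp add: v_def r field_simps)
    also have "\<dots> \<le> 1 / (real m * (real m / 2))"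
      using m by (intro divide_left_mono mult_left_mono mult_pos_pos) auto
    also have "\<dots> = 2 * i" by (simp add: i_def power2_eq_square)
    finally show "v - 1 / real m \<le> 2 * i" .
    show "1 / real m \<le> v" unfolding v_def r using m by (intro divide_left_mono) auto
  qed
  have vs: "\<bar>v - s\<bar> \<le> e + 2 * i" using v by (simp add: e_def)
  have P1: "\<bar>P\<bar> \<le> 1"
  proof -
    have "0 \<le> P" unfolding P_def by (intro Bochner_Integration.integral_nonneg f)
    moreover have "P \<le> 1" unfolding P_def
      using f by (intro measure_pmf.integral_le_const measure_pmf.integrable_const_bound[where B = 1]) auto
    ultimately show ?thesis by simp
  qed
  have BP: "\<bar>u * (B - P)\<bar> \<le> 4 * \<beta>\<^sup>2 * i"
  proof -
    define y where "y = 2 * \<beta>\<^sup>2 / real m"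
    \<comment> \<open>y <= 1 is the point of the hypothesis m >= 2 * \<beta>^2: it gives exp y - 1
      <= y + y^2 <= 2 * y.\<close>
    have y: "0 \<le> y" "y \<le> 1" using m m0 by (auto simp: y_def)
    have "exp y \<le> 1 + y + y\<^sup>2" using y by (intro exp_bound)
    moreover have "y\<^sup>2 \<le> y" using y by (simp add: power2_eq_square mult_left_le)
    moreover have "\<bar>B - P\<bar> \<le> exp y - 1"
      unfolding B_def P_def y_def using beta_pos m(2) f by (rule expectation_binomial_poisson)
    ultimately have "\<bar>B - P\<bar> \<le> 2 * y" by linarith
    then have "u * \<bar>B - P\<bar> \<le> 1 / real m * (2 * y)" using u m0 by (intro mult_mono) auto
    then show ?thesis using u(1) by (simp add: abs_mult y_def i_def power2_eq_square)
  qed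
  have arrive: "measure_pmf.expectation (arrive \<beta> (m, d)) (\<lambda>x. f (snd x)) =
      u * B + \<beta> * u * f (Suc d) + (1 - u - \<beta> * u) * f d"
  proof -
    have mu: "real m * u = 1 - u" by (simp add: u_def field_simps)
    have "real m * (\<beta> / real m * f (Suc d) + (1 - \<beta> / real m) * f d) =
        \<beta> * f (Suc d) + (real m - \<beta>) * f d"
      using m0 by (simp add: field_simps)
    then have "measure_pmf.expectation (arrive \<beta> (m, d)) (\<lambda>x. f (snd x)) =
        (B + (\<beta> * f (Suc d) + (real m - \<beta>) * f d)) * u"
      using beta_pos by (simp add: expectation_arrive q B_def u_def)
    also have "\<dots> = u * B + \<beta> * u * f (Suc d) + (real m * u - \<beta> * u) * f d"
      by (simp add: algebra_simps)
    finally show ?thesis unfolding mu .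
  qed
  have depart: "measure_pmf.expectation (depart (m, d)) (\<lambda>x. f (snd x)) =
      real d * v * f (d - 1) + (1 - real d * v) * f d"
    using m d by (subst expectation_depart) (auto simp: v_def)
  have "\<bar>real d * v - c\<bar> \<le> real d * (e + 2 * i)"
  proof -
    \<comment> \<open>Since d * v is at most 1 already, cutting d * s off at 1 cannot increase its
      distance to d * v.\<close>
    have "real d * v \<le> 1" using d m by (simp add: v_def)
    then have "\<bar>real d * v - c\<bar> \<le> \<bar>real d * v - real d * s\<bar>" by (simp add: c_def)
    also have "\<dots> = real d * \<bar>v - s\<bar>" by (simp add: right_diff_distrib[symmetric] abs_mult)
    also have "\<dots> \<le> real d * (e + 2 * i)" using vs by (intro mult_left_mono) auto
    finally show ?thesis .
  qed
  moreover have "\<bar>f (d - 1) - f d\<bar> \<le> 1" using f(1,2)[of d] f(1,2)[of "d - 1"] by linarith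
  ultimately have D: "\<bar>(real d * v - c) * (f (d - 1) - f d)\<bar> \<le> real d * (e + 2 * i) * 1"
    unfolding abs_mult by (intro mult_mono) auto
  have A: "\<bar>u * (B - P) + (u - s) * (P + \<beta> * f (Suc d) - (1 + \<beta>) * f d)\<bar> \<le>
      4 * \<beta>\<^sup>2 * i + (e + i) * (2 + 2 * \<beta>)"
  proof -
    have "0 \<le> \<beta> * f (Suc d)" "\<beta> * f (Suc d) \<le> \<beta>" "0 \<le> (1 + \<beta>) * f d" "(1 + \<beta>) * f d \<le> 1 + \<beta>"
      using f beta_pos by (auto intro: mult_left_le)
    then have "\<bar>P + \<beta> * f (Suc d) - (1 + \<beta>) * f d\<bar> \<le> 2 + 2 * \<beta>" using P1 beta_pos by linarith
    then have "\<bar>(u - s) * (P + \<beta> * f (Suc d) - (1 + \<beta>) * f d)\<bar> \<le> (e + i) * (2 + 2 * \<beta>)"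
      unfolding abs_mult using us by (intro mult_mono) auto
    then show ?thesis using BP by linarith
  qed
  have "p * (u * B + \<beta> * u * f (Suc d) + (1 - u - \<beta> * u) * f d)
      + (1 - p) * (real d * v * f (d - 1) + (1 - real d * v) * f d)
      - (p * s * P + surviving_step s f d) =
      p * (u * (B - P) + (u - s) * (P + \<beta> * f (Suc d) - (1 + \<beta>) * f d)) +
      (1 - p) * ((real d * v - c) * (f (d - 1) - f d))"
    unfolding surviving_step_def c_def[symmetric] by (simp add: algebra_simps)
  also have "\<bar>\<dots>\<bar> \<le> p * (4 * \<beta>\<^sup>2 * i + (e + i) * (2 + 2 * \<beta>)) + (1 - p) * (real d * (e + 2 * i))"
    using A D p_bounds
    by (intro order_trans[OF abs_triangle_ineq] add_mono) (auto simp: abs_mult intro!: mult_left_mono)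
  also have "\<dots> \<le> 1 * (4 * \<beta>\<^sup>2 * i + (e + i) * (2 + 2 * \<beta>)) + 1 * (real d * (e + 2 * i))"
    using p_bounds beta_pos \<open>e \<ge> 0\<close> \<open>i \<ge> 0\<close> by (intro add_mono mult_right_mono) auto
  \<comment> \<open>In the constant, 4 * \<beta>^2 pays for the Poisson approximation and 2 *
    \<beta> + 2 for the arrival rates; the summand 2 also absorbs e + 2 * i <= 2 * (e + i) from the
    removal.\<close>
  also have "\<dots> \<le> (1 + real d) * ((4 * \<beta>\<^sup>2 + 2 * \<beta> + 2) * (e + i))"
  proof -
    have "real d * (e + 2 * i) \<le> real d * ((4 * \<beta>\<^sup>2 + 2 * \<beta> + 2) * (e + i))"
    proof (rule mult_left_mono)
      have "e + 2 * i \<le> 2 * (e + i)" using \<open>e \<ge> 0\<close> by simp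
      also have "\<dots> \<le> (4 * \<beta>\<^sup>2 + 2 * \<beta> + 2) * (e + i)"
        using beta_pos \<open>e \<ge> 0\<close> \<open>i \<ge> 0\<close> by (intro mult_right_mono) auto
      finally show "e + 2 * i \<le> (4 * \<beta>\<^sup>2 + 2 * \<beta> + 2) * (e + i)" .
    qed simp
    moreover have "0 \<le> 4 * \<beta>\<^sup>2 * e" using \<open>e \<ge> 0\<close> by simp
    ultimately show ?thesis by (simp add: algebra_simps)
  qed
  finally show ?thesis
    unfolding arrive depart by (simp add: P_def e_def i_def)
qed

section \<open>Error of one step and its accumulation\<close>

lemma size_lower_tail:
  obtains \<rho> where "0 < \<rho>" "\<rho> < 1" "\<And>n. E n (\<lambda>x. of_bool (real (fst x) < \<epsilon> * real n)) \<le> \<rho> ^ n"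
proof -
  \<comment> \<open>h is the moment factor of \<open>E_exp_size_le\<close> tilted by exp (\<epsilon>
    * t), the price of a threshold at half the typical size. As h 0 = 1 and the slope there is -
    \<epsilon>, some t > 0 has h t < 1, and the Chernoff bound is a power of it.\<close>
  define h where "h = (\<lambda>t. p * exp (- (1 - \<epsilon>) * t) + (1 - p) * exp ((1 + \<epsilon>) * t))"
  have "(h has_real_derivative p * (- (1 - \<epsilon>)) + (1 - p) * (1 + \<epsilon>)) (at 0)"
    unfolding h_def by (auto intro!: derivative_eq_intros)
  moreover have "p * (- (1 - \<epsilon>)) + (1 - p) * (1 + \<epsilon>) = - \<epsilon>" by (simp add: p_def field_simps)
  ultimately obtain \<delta> where \<delta>: "\<delta> > 0" "\<And>t. t > 0 \<Longrightarrow> t < \<delta> \<Longrightarrow> h t < h 0"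
    using DERIV_neg_dec_right[of h "- \<epsilon>" 0] eps_pos by auto
  define t where "t = \<delta> / 2"
  have t: "t > 0" "h t < 1" using \<delta>(1) \<delta>(2)[of t] by (auto simp: t_def h_def)
  have ht: "h t = exp (\<epsilon> * t) * (p * exp (- t) + (1 - p) * exp t)"
    by (simp add: h_def distrib_left exp_add[symmetric] algebra_simps)
  have "h t > 0" unfolding h_def using p_bounds by (intro add_pos_nonneg) auto
  moreover have "E n (\<lambda>x. of_bool (real (fst x) < \<epsilon> * real n)) \<le> h t ^ n" for n
  proof -
    have "E n (\<lambda>x. of_bool (real (fst x) < \<epsilon> * real n)) \<le>
        E n (\<lambda>x. exp (\<epsilon> * t) ^ n * exp (- t * real (fst x)))"
    proof (rule E_mono, goal_cases)
      case (1 m d)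
      have "exp (\<epsilon> * t) ^ n * exp (- t * real m) = exp (t * (\<epsilon> * real n - real m))"
        by (simp add: exp_of_nat_mult[symmetric] exp_add[symmetric] algebra_simps)
      then show ?case using t(1) by (auto simp: of_bool_def)
    qed
    also have "\<dots> = exp (\<epsilon> * t) ^ n * E n (\<lambda>x. exp (- t * real (fst x)))" by simp
    also have "\<dots> \<le> exp (\<epsilon> * t) ^ n * (p * exp (- t) + (1 - p) * exp t) ^ n"
      using t(1) by (intro mult_left_mono E_exp_size_le) auto
    also have "\<dots> = h t ^ n" by (simp add: ht power_mult_distrib)
    finally show ?thesis .
  qed
  ultimately show ?thesis using that t(2) by blast
qed

lemma E_size_deviation_le: "E n (\<lambda>x. \<bar>real (fst x) - 2 * \<epsilon> * real n\<bar>) \<le> sqrt (real n)"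
proof -
  have "(E n (\<lambda>x. \<bar>real (fst x) - 2 * \<epsilon> * real n\<bar>))\<^sup>2 \<le> E n (\<lambda>x. \<bar>real (fst x) - 2 * \<epsilon> * real n\<bar>\<^sup>2)"
    using measure_pmf.variance_positive[of "size_degree \<beta> \<epsilon> n" "\<lambda>x. \<bar>real (fst x) - 2 * \<epsilon> * real n\<bar>"]
    by (subst (asm) measure_pmf.variance_eq) (auto intro: integrable_E)
  also have "\<dots> \<le> real n" using E_size_variance_le[of n] by simp
  finally show ?thesis by (rule real_le_rsqrt)
qed

text \<open>On M >= \<epsilon> * n the difference of 1/M and s is at most |M - 2 * \<epsilon> * n| /
  (\<epsilon> * n)^2, which averages to order n^(-3/2). Elsewhere the error is at most 1 and the
  probability is exponentially small.\<close>

lemma one_step_error: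
  obtains A N where "A \<ge> 0" "N > 0"
    "\<And>n. n \<ge> N \<Longrightarrow> (1 + \<beta>) / (2 * \<epsilon> * real n) \<le> 1"
    "\<And>n f. n \<ge> N \<Longrightarrow> (\<And>k. 0 \<le> f k) \<Longrightarrow> (\<And>k. f k \<le> 1) \<Longrightarrow>
      \<bar>E (Suc n) (\<lambda>x. f (snd x)) - E n (\<lambda>x. p * (1 / (2 * \<epsilon> * real n)) *
          measure_pmf.expectation (poisson_pmf \<beta>) f + surviving_step (1 / (2 * \<epsilon> * real n)) f (snd x))\<bar>
      \<le> A / (real n * sqrt (real n))"
proof -
  obtain \<rho> where \<rho>: "0 < \<rho>" "\<rho> < 1" "\<And>n. E n (\<lambda>x. of_bool (real (fst x) < \<epsilon> * real n)) \<le> \<rho> ^ n"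
    using size_lower_tail by blast
  define C where "C = 4 * \<beta>\<^sup>2 + 2 * \<beta> + 2"
  \<comment> \<open>The 1 covers the tail; 1 + 2 * \<beta> bounds the weighted mean of 1 + D, and
    the remaining 2 comes from adding 1 to the deviation of order sqrt n.\<close>
  define A where "A = 1 + 2 * C * (1 + 2 * \<beta>) / \<epsilon>\<^sup>2"
  have C: "C > 0" using beta_pos by (auto simp: C_def intro!: add_nonneg_pos)
  have "A \<ge> 0" using C beta_pos eps_pos by (auto simp: A_def intro!: add_nonneg_nonneg divide_nonneg_nonneg)
  have "\<forall>\<^sub>F n in sequentially. \<rho> ^ n \<le> 1 / (real n * sqrt (real n))"
    using \<rho>(1,2) by real_asymp
  moreover have "\<forall>\<^sub>F n in sequentially. 2 + 2 * \<beta> + 2 * \<beta>\<^sup>2 \<le> \<epsilon> * real n"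
    using eps_pos by real_asymp
  ultimately have "\<forall>\<^sub>F n in sequentially. \<rho> ^ n \<le> 1 / (real n * sqrt (real n)) \<and>
      2 + 2 * \<beta> + 2 * \<beta>\<^sup>2 \<le> \<epsilon> * real n"
    by (rule eventually_conj)
  then obtain N0 where N0: "\<And>n. n \<ge> N0 \<Longrightarrow> \<rho> ^ n \<le> 1 / (real n * sqrt (real n))"
      "\<And>n. n \<ge> N0 \<Longrightarrow> 2 + 2 * \<beta> + 2 * \<beta>\<^sup>2 \<le> \<epsilon> * real n"
    by (auto simp: eventually_sequentially)
  define N where "N = max 1 N0"
  have step: "\<bar>E (Suc n) (\<lambda>x. f (snd x)) - E n (\<lambda>x. p * (1 / (2 * \<epsilon> * real n)) *
          measure_pmf.expectation (poisson_pmf \<beta>) f + surviving_step (1 / (2 * \<epsilon> * real n)) f (snd x))\<bar>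
      \<le> A / (real n * sqrt (real n))"
    if n: "n \<ge> N" and f: "\<And>k. 0 \<le> f k" "\<And>k. f k \<le> 1" for n f
  proof -
    define s where "s = 1 / (2 * \<epsilon> * real n)"
    define P where "P = measure_pmf.expectation (poisson_pmf \<beta>) f"
    define Y where "Y = (\<lambda>m. \<bar>real m - 2 * \<epsilon> * real n\<bar>)"
    define L where "L = C / (\<epsilon>\<^sup>2 * (real n)\<^sup>2)"
    define PP where "PP = (\<lambda>x. p * measure_pmf.expectation (arrive \<beta> x) (\<lambda>x. f (snd x))
        + (1 - p) * measure_pmf.expectation (depart x) (\<lambda>x. f (snd x)))"
    define QQ where "QQ = (\<lambda>x :: nat \<times> nat. p * s * P + surviving_step s f (snd x))"
    \<comment> \<open>The last summand couples D with the fluctuation of M;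
      \<open>E_degree_le\<close> with weight L * (Y m + 1) decouples them.\<close>
    define err where "err = (\<lambda>x. of_bool (real (fst x) < \<epsilon> * real n) +
        L * (Y (fst x) + 1) + (case x of (m, d) \<Rightarrow> real d * (L * (Y m + 1))))"
    have n1: "real n \<ge> 1" using n by (simp add: N_def)
    have big: "2 + 2 * \<beta> + 2 * \<beta>\<^sup>2 \<le> \<epsilon> * real n" using N0(2) n by (simp add: N_def)
    have en: "\<epsilon> * real n > 0" using n1 eps_pos by simp
    have s: "0 \<le> s" "s * (1 + \<beta>) \<le> 1"
    proof -
      have "1 + \<beta> \<le> 2 * (\<epsilon> * real n)" using big beta_pos zero_le_power2[of \<beta>] by linarith
      then show "s * (1 + \<beta>) \<le> 1" using en by (simp add: s_def mult_ac)
    qed (use en in \<open>simp add: s_def\<close>)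
    have L: "L \<ge> 0" using C by (simp add: L_def)
    have P: "0 \<le> P" "P \<le> 1"
      unfolding P_def using f
      by (auto intro!: Bochner_Integration.integral_nonneg measure_pmf.integral_le_const
          measure_pmf.integrable_const_bound[where B = 1])
    have QQ: "0 \<le> QQ x" "QQ x \<le> 1" for x
    proof -
      have ps: "p * s \<ge> 0" using p_bounds s by simp
      have "0 \<le> p * s * P" "p * s * P \<le> p * s * 1"
        using ps P by (auto intro: mult_left_le)
      then show "0 \<le> QQ x" "QQ x \<le> 1"
        using surviving_step_bounds[where f = f and d = "snd x", OF s f] by (auto simp: QQ_def)
    qed
    have bound01: "0 \<le> measure_pmf.expectation M (\<lambda>x. f (snd x))"
        "measure_pmf.expectation M (\<lambda>x. f (snd x)) \<le> 1" for M :: "(nat \<times> nat) pmf"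
      using f by (auto intro!: Bochner_Integration.integral_nonneg measure_pmf.integral_le_const
          measure_pmf.integrable_const_bound[where B = 1])
    have PP: "0 \<le> PP x" "PP x \<le> 1" for x
    proof -
      show "0 \<le> PP x" unfolding PP_def using p_bounds bound01 by simp
      have "PP x \<le> p * 1 + (1 - p) * 1"
        unfolding PP_def using p_bounds bound01 by (intro add_mono mult_left_mono) auto
      then show "PP x \<le> 1" by simp
    qed
    have "\<bar>E (Suc n) (\<lambda>x. f (snd x)) - E n QQ\<bar> = \<bar>E n (\<lambda>x. PP x - QQ x)\<bar>"
      unfolding E_Suc E_diff by (simp add: PP_def)
    also have "\<dots> \<le> E n (\<lambda>x. \<bar>PP x - QQ x\<bar>)" by (rule integral_abs_bound)
    also have "\<dots> \<le> E n err"
    proof (rule E_mono, goal_cases)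
      case (1 m d)
      have Y: "Y m \<ge> 0" by (simp add: Y_def)
      show ?case
      proof (cases "real m < \<epsilon> * real n")
        case True
        have "\<bar>PP (m, d) - QQ (m, d)\<bar> \<le> 1"
          using PP[of "(m, d)"] QQ[of "(m, d)"] by linarith
        also have "\<dots> \<le> err (m, d)" using True L Y by (simp add: err_def)
        finally show ?thesis .
      next
        case False
        then have m: "real m \<ge> \<epsilon> * real n" by simp
        have m0: "real m > 0" using m en by linarith
        have large: "real m \<ge> 2" "real m \<ge> 2 * \<beta>" "real m \<ge> 2 * \<beta>\<^sup>2"
          using m big beta_pos zero_le_power2[of \<beta>] by linarith+
        have "\<bar>PP (m, d) - QQ (m, d)\<bar> \<le> (1 + real d) * (C * (\<bar>1 / real m - s\<bar> + 1 / (real m)\<^sup>2))"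
          using step_compare[where f = f, OF large 1(2) s(1) f] by (simp add: PP_def QQ_def C_def P_def)
        also have "\<dots> \<le> (1 + real d) * (C * ((Y m + 1) / (\<epsilon>\<^sup>2 * (real n)\<^sup>2)))"
        proof (intro mult_left_mono)
          have "1 / real m - s = (2 * \<epsilon> * real n - real m) / (real m * (2 * (\<epsilon> * real n)))"
            using m0 eps_pos n1 by (simp add: s_def field_simps)
          then have "\<bar>1 / real m - s\<bar> = Y m / (real m * (2 * (\<epsilon> * real n)))"
            using m0 eps_pos by (simp add: Y_def abs_mult abs_minus_commute)
          also have "\<dots> \<le> Y m / ((\<epsilon> * real n) * (\<epsilon> * real n))"
          proof (rule divide_left_mono[OF _ Y])
            show "(\<epsilon> * real n) * (\<epsilon> * real n) \<le> real m * (2 * (\<epsilon> * real n))"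
              using m en m0 by (intro mult_mono[OF m]) auto
            show "0 < real m * (2 * (\<epsilon> * real n)) * ((\<epsilon> * real n) * (\<epsilon> * real n))"
              using en m0 by (intro mult_pos_pos[OF mult_pos_pos mult_pos_pos]) linarith+
          qed
          finally have a: "\<bar>1 / real m - s\<bar> \<le> Y m / (\<epsilon>\<^sup>2 * (real n)\<^sup>2)"
            by (simp add: power2_eq_square mult_ac)
          have "1 / (real m)\<^sup>2 \<le> 1 / (\<epsilon> * real n)\<^sup>2"
            using m en m0 eps_pos n1
            by (intro divide_left_mono power_mono mult_pos_pos zero_less_power) linarith+
          then have b: "1 / (real m)\<^sup>2 \<le> 1 / (\<epsilon>\<^sup>2 * (real n)\<^sup>2)" by (simp add: power_mult_distrib)
          show "\<bar>1 / real m - s\<bar> + 1 / (real m)\<^sup>2 \<le> (Y m + 1) / (\<epsilon>\<^sup>2 * (real n)\<^sup>2)"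
            using add_mono[OF a b] by (simp add: add_divide_distrib)
        qed (use C in auto)
        also have "\<dots> = (1 + real d) * (L * (Y m + 1))" by (simp add: L_def)
        also have "\<dots> = err (m, d)" using False by (simp add: err_def distrib_right)
        finally show ?thesis .
      qed
    qed
    also have "\<dots> = E n (\<lambda>x. of_bool (real (fst x) < \<epsilon> * real n)) + E n (\<lambda>x. L * (Y (fst x) + 1)) +
        E n (\<lambda>(m, d). real d * (L * (Y m + 1)))"
      unfolding err_def E_add ..
    also have "\<dots> \<le> \<rho> ^ n + E n (\<lambda>x. L * (Y (fst x) + 1)) + 2 * \<beta> * E n (\<lambda>x. L * (Y (fst x) + 1))"
      using L by (intro add_mono \<rho>(3) order_refl E_degree_le) (auto simp: Y_def)
    also have "\<dots> = \<rho> ^ n + (1 + 2 * \<beta>) * L * (E n (\<lambda>x. Y (fst x)) + 1)"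
      by (simp add: E_add distrib_right)
    also have "\<dots> \<le> 1 / (real n * sqrt (real n)) + (1 + 2 * \<beta>) * L * (2 * sqrt (real n))"
    proof (intro add_mono mult_left_mono)
      show "\<rho> ^ n \<le> 1 / (real n * sqrt (real n))" using N0(1) n by (simp add: N_def)
      have "E n (\<lambda>x. Y (fst x)) \<le> sqrt (real n)" unfolding Y_def by (rule E_size_deviation_le)
      moreover have "1 \<le> sqrt (real n)" using n1 by simp
      ultimately show "E n (\<lambda>x. Y (fst x)) + 1 \<le> 2 * sqrt (real n)" by linarith
    qed (use L beta_pos in auto)
    also have "\<dots> = A / (real n * sqrt (real n))"
    proof -
      have "sqrt (real n) / (real n)\<^sup>2 = 1 / (real n * sqrt (real n))"
        using n1 by (simp add: field_simps power2_eq_square)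
      moreover have "L * sqrt (real n) = C / \<epsilon>\<^sup>2 * (sqrt (real n) / (real n)\<^sup>2)"
        by (simp add: L_def)
      ultimately have "L * sqrt (real n) = C / \<epsilon>\<^sup>2 * (1 / (real n * sqrt (real n)))" by simp
      moreover have "(1 + 2 * \<beta>) * L * (2 * sqrt (real n)) = 2 * (1 + 2 * \<beta>) * (L * sqrt (real n))"
        by simp
      ultimately have "(1 + 2 * \<beta>) * L * (2 * sqrt (real n)) =
          2 * (1 + 2 * \<beta>) * (C / \<epsilon>\<^sup>2 * (1 / (real n * sqrt (real n))))"
        by simp
      also have "\<dots> = 2 * C * (1 + 2 * \<beta>) / \<epsilon>\<^sup>2 / (real n * sqrt (real n))" by simp
      finally show ?thesis unfolding A_def add_divide_distrib by simp
    qed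
    finally show ?thesis unfolding QQ_def s_def P_def .
  qed
  show ?thesis
  proof (rule that[OF \<open>A \<ge> 0\<close> _ _ step])
    show "N > 0" by (simp add: N_def)
    fix n assume n: "n \<ge> N"
    have "2 + 2 * \<beta> + 2 * \<beta>\<^sup>2 \<le> \<epsilon> * real n" using N0(2) n by (simp add: N_def)
    then have "1 + \<beta> \<le> 2 * \<epsilon> * real n" using beta_pos zero_le_power2[of \<beta>] by linarith
    then show "(1 + \<beta>) / (2 * \<epsilon> * real n) \<le> 1" using beta_pos by (simp add: divide_le_eq_1)
  qed
qed

text \<open>From n to n + 1 the target shrinks only by about 1 - 1 / (2 * n), while the contraction
  is 1 - 1 / n. The surplus B / (2 * n * sqrt n) absorbs the error, hence 2 * A <= B.\<close>

lemma sqrt_recursion: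
  assumes "n > 0" "2 * A \<le> B" "0 \<le> B"
  shows "(1 - 1 / real n) * (B / sqrt (real n)) + A / (real n * sqrt (real n)) \<le> B / sqrt (real (Suc n))"
proof -
  define y where "y = real n"
  have y: "y \<ge> 1" using assms by (simp add: y_def)
  have "(1 - 1 / (2 * y)) * (1 - 1 / (2 * y)) \<le> y / (y + 1)"
    using y by (simp add: field_simps)
  then have "(1 - 1 / (2 * y))\<^sup>2 \<le> y / (y + 1)" by (simp only: power2_eq_square)
  then have "1 - 1 / (2 * y) \<le> sqrt (y / (y + 1))" by (rule real_le_rsqrt)
  then have "B / sqrt y * (1 - 1 / (2 * y)) \<le> B / sqrt y * (sqrt y / sqrt (y + 1))"
    using assms y by (intro mult_left_mono) (auto simp: real_sqrt_divide)
  also have "\<dots> = B / sqrt (y + 1)" using y by simp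
  finally have "B / sqrt y * (1 - 1 / (2 * y)) \<le> B / sqrt (y + 1)" .
  moreover have "A / (y * sqrt y) \<le> (B / 2) / (y * sqrt y)"
    using assms y by (intro divide_right_mono) auto
  moreover have "(1 - 1 / y) * (B / sqrt y) + (B / 2) / (y * sqrt y) = B / sqrt y * (1 - 1 / (2 * y))"
    using y by (simp add: field_simps)
  ultimately show ?thesis by (simp add: y_def add.commute)
qed

text \<open>The bound has to be uniform in f and K, since the induction step applies it to another
  test function with a larger K.\<close>

lemma degree_close:
  "\<exists>B. \<forall>\<^sub>F n in sequentially. \<forall>K f. (\<forall>k. 0 \<le> f k \<and> f k \<le> 1) \<longrightarrow> (\<forall>k\<ge>K. f k = 0) \<longrightarrow>
      \<bar>E n (\<lambda>x. f (snd x)) - (\<Sum>k<K. limit_weight k * f k)\<bar> \<le> B / sqrt (real n)"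
proof -
  obtain A N where A: "A \<ge> 0" and N: "N > 0"
    and fit: "\<And>n. n \<ge> N \<Longrightarrow> (1 + \<beta>) / (2 * \<epsilon> * real n) \<le> 1"
    and step: "\<And>n f. n \<ge> N \<Longrightarrow> (\<And>k. 0 \<le> f k) \<Longrightarrow> (\<And>k. f k \<le> 1) \<Longrightarrow>
      \<bar>E (Suc n) (\<lambda>x. f (snd x)) - E n (\<lambda>x. p * (1 / (2 * \<epsilon> * real n)) *
          measure_pmf.expectation (poisson_pmf \<beta>) f + surviving_step (1 / (2 * \<epsilon> * real n)) f (snd x))\<bar>
      \<le> A / (real n * sqrt (real n))"
    using one_step_error by metis
  define C where "C = (1 - p) * (r * (\<beta> * p / (1 - p))\<^sup>2)"
  have C: "C \<ge> 0" using p_bounds r_bounds by (auto simp: C_def intro!: mult_nonneg_nonneg)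
  define A' where "A' = A + C / (4 * \<epsilon>\<^sup>2)"
  \<comment> \<open>\<open>sqrt (real N)\<close> makes the trivial bound 1 sufficient at n = N, and
    2 * A' is what \<open>sqrt_recursion\<close> asks for.\<close>
  define B where "B = max (sqrt (real N)) (2 * A')"
  have B: "2 * A' \<le> B" "0 \<le> B" "sqrt (real N) \<le> B" by (auto simp: B_def le_max_iff_disj)
  have "\<bar>E n (\<lambda>x. f (snd x)) - (\<Sum>k<K. limit_weight k * f k)\<bar> \<le> B / sqrt (real n)"
    if "n \<ge> N" "\<And>k. 0 \<le> f k" "\<And>k. f k \<le> 1" "\<And>k. k \<ge> K \<Longrightarrow> f k = 0" for n K f
    using that
  proof (induction n arbitrary: K f rule: nat_induct_at_least)
    case base
    have "0 \<le> E N (\<lambda>x. f (snd x))" "E N (\<lambda>x. f (snd x)) \<le> 1"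
      using base by (auto intro!: Bochner_Integration.integral_nonneg measure_pmf.integral_le_const
          measure_pmf.integrable_const_bound[where B = 1])
    moreover have "0 \<le> (\<Sum>k<K. limit_weight k * f k)"
      using base limit_weight_nonneg by (intro sum_nonneg mult_nonneg_nonneg) auto
    moreover have "(\<Sum>k<K. limit_weight k * f k) \<le> (\<Sum>k<K. limit_weight k)"
      using base limit_weight_nonneg by (intro sum_mono mult_left_le) auto
    moreover have "(\<Sum>k<K. limit_weight k) \<le> 1" by (rule sum_limit_weight_le_1) simp
    ultimately have "\<bar>E N (\<lambda>x. f (snd x)) - (\<Sum>k<K. limit_weight k * f k)\<bar> \<le> 1" by linarith
    also have "1 \<le> B / sqrt (real N)" using B(3) N by simp
    finally show ?case .
  next
    case (Suc n)
    define s where "s = 1 / (2 * \<epsilon> * real n)"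
    define P where "P = measure_pmf.expectation (poisson_pmf \<beta>) f"
    have n: "n > 0" using Suc N by linarith
    have s: "0 < s" "s * (1 + \<beta>) \<le> 1" "s < 1" "1 / real n \<le> p * s" "p * s < 1"
    proof -
      show "0 < s" using n eps_pos by (simp add: s_def)
      show sb: "s * (1 + \<beta>) \<le> 1" using fit[OF Suc.hyps] by (simp add: s_def)
      have "s < s * (1 + \<beta>)" using \<open>0 < s\<close> beta_pos by (simp add: distrib_left)
      then show "s < 1" using sb by linarith
      have "1 \<le> r" by (rule r_bounds)
      then have "1 / real n \<le> r / real n" by (intro divide_right_mono) auto
      also have "\<dots> = p * s" by (simp add: s_def r_def)
      finally show "1 / real n \<le> p * s" .
      have "p * s \<le> 1 * s" using p_bounds \<open>0 < s\<close> by (intro mult_right_mono) auto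
      then show "p * s < 1" using \<open>s < 1\<close> by simp
    qed
    \<comment> \<open>Renormalising by the surviving mass brings the pulled-back function into
      [0, 1] again; the factor 1 - p * s taken out is the contraction.\<close>
    define g where "g = (\<lambda>k. surviving_step s f k / (1 - p * s))"
    have g: "0 \<le> g k" "g k \<le> 1" for k
      using surviving_step_bounds[of s f k] s Suc.prems by (auto simp: g_def)
    have g0: "g k = 0" if "k \<ge> Suc K" for k
      using Suc.prems(3) that by (simp add: g_def surviving_step_def)
    have surv: "surviving_step s f k = (1 - p * s) * g k" for k using s by (simp add: g_def)
    have IH: "\<bar>E n (\<lambda>x. g (snd x)) - (\<Sum>k<Suc K. limit_weight k * g k)\<bar> \<le> B / sqrt (real n)"
      using Suc.IH[of g "Suc K"] g g0 by blast
    \<comment> \<open>I and J apply the same frozen step to the law at time n and to the limit law.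
      The reset parts cancel in I - J, which contracts; J is close to the limit by almost
      invariance, and I to the law at time n + 1 by the one-step error.\<close>
    define I where "I = E n (\<lambda>x. p * s * P + surviving_step s f (snd x))"
    define J where "J = p * s * P + (\<Sum>k<Suc K. limit_weight k * surviving_step s f k)"
    have "I = p * s * P + (1 - p * s) * E n (\<lambda>x. g (snd x))"
      unfolding I_def E_add surv by simp
    moreover have "J = p * s * P + (1 - p * s) * (\<Sum>k<Suc K. limit_weight k * g k)"
      unfolding J_def surv by (simp add: sum_distrib_left mult_ac del: sum.lessThan_Suc)
    ultimately have "I - J = (1 - p * s) * (E n (\<lambda>x. g (snd x)) - (\<Sum>k<Suc K. limit_weight k * g k))"
      by (simp add: right_diff_distrib del: sum.lessThan_Suc)
    then have "\<bar>I - J\<bar> = (1 - p * s) * \<bar>E n (\<lambda>x. g (snd x)) - (\<Sum>k<Suc K. limit_weight k * g k)\<bar>"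
      using s by (simp add: abs_mult)
    also have "\<dots> \<le> (1 - 1 / real n) * (B / sqrt (real n))"
      using IH s by (intro mult_mono) auto
    finally have IJ: "\<bar>I - J\<bar> \<le> (1 - 1 / real n) * (B / sqrt (real n))" .
    have "\<bar>J - (\<Sum>k<K. limit_weight k * f k)\<bar> \<le> s\<^sup>2 * C"
      unfolding J_def P_def C_def using s Suc.prems by (intro limit_weight_almost_invariant) auto
    also have "s\<^sup>2 * C = C / (4 * \<epsilon>\<^sup>2) / (real n * real n)"
      by (simp add: s_def power2_eq_square field_simps)
    also have "\<dots> \<le> C / (4 * \<epsilon>\<^sup>2) / (real n * sqrt (real n))"
    proof (intro divide_left_mono mult_left_mono mult_pos_pos)
      have "sqrt (real n) * 1 \<le> sqrt (real n) * sqrt (real n)" using n by (intro mult_left_mono) auto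
      then show "sqrt (real n) \<le> real n" by simp
    qed (use C n in auto)
    finally have "\<bar>J - (\<Sum>k<K. limit_weight k * f k)\<bar> \<le> C / (4 * \<epsilon>\<^sup>2) / (real n * sqrt (real n))" .
    moreover have "\<bar>E (Suc n) (\<lambda>x. f (snd x)) - I\<bar> \<le> A / (real n * sqrt (real n))"
      unfolding I_def P_def s_def using Suc.hyps Suc.prems(1,2) by (rule step)
    ultimately have "\<bar>E (Suc n) (\<lambda>x. f (snd x)) - (\<Sum>k<K. limit_weight k * f k)\<bar> \<le>
        (1 - 1 / real n) * (B / sqrt (real n)) + A' / (real n * sqrt (real n))"
      using IJ unfolding A'_def add_divide_distrib by linarith
    also have "\<dots> \<le> B / sqrt (real (Suc n))" using n B by (intro sqrt_recursion)
    finally show ?case .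
  qed
  then show ?thesis unfolding eventually_sequentially by blast
qed

text \<open>The bound for the indicator of A cut off at K does not depend on K, so it passes to A by
  continuity from below of both measures.\<close>

lemma tv_dist_root_degree:
  "\<exists>B. \<forall>\<^sub>F n in sequentially.
     tv_dist (measure_pmf (root_degree \<beta> \<epsilon> n)) (limit_degree \<beta> \<epsilon>) \<le> B / sqrt (real n)"
proof -
  interpret L: prob_space "limit_degree \<beta> \<epsilon>"
    using beta_pos eps_pos eps_le by (rule prob_space_limit_degree)
  have sets: "sets (limit_degree \<beta> \<epsilon>) = UNIV"
    using beta_pos eps_pos eps_le by (rule sets_limit_degree)
  obtain B where close: "\<forall>\<^sub>F n in sequentially. \<forall>K f. (\<forall>k. 0 \<le> f k \<and> f k \<le> 1) \<longrightarrow> (\<forall>k\<ge>K. f k = 0) \<longrightarrow>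
      \<bar>E n (\<lambda>x. f (snd x)) - (\<Sum>k<K. limit_weight k * f k)\<bar> \<le> B / sqrt (real n)"
    using degree_close ..
  have tv: "tv_dist (measure_pmf (root_degree \<beta> \<epsilon> n)) (limit_degree \<beta> \<epsilon>) \<le> B / sqrt (real n)"
    if n: "\<forall>K f. (\<forall>k. 0 \<le> f k \<and> f k \<le> 1) \<longrightarrow> (\<forall>k\<ge>K. f k = 0) \<longrightarrow>
      \<bar>E n (\<lambda>x. f (snd x)) - (\<Sum>k<K. limit_weight k * f k)\<bar> \<le> B / sqrt (real n)" for n
    unfolding tv_dist_def
  proof (rule cSUP_least)
    fix A :: "nat set"
    define M where "M = measure_pmf (root_degree \<beta> \<epsilon> n)"
    have fin: "\<bar>measure M (A \<inter> {..<K}) - measure (limit_degree \<beta> \<epsilon>) (A \<inter> {..<K})\<bar> \<le> B / sqrt (real n)"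
      for K
    proof -
      have "measure M (A \<inter> {..<K}) = E n (\<lambda>x. indicator (A \<inter> {..<K}) (snd x))"
        unfolding M_def root_degree_eq
        by (subst integral_map_pmf[symmetric]) simp
      moreover have "measure (limit_degree \<beta> \<epsilon>) (A \<inter> {..<K}) =
          (\<Sum>k<K. limit_weight k * indicator (A \<inter> {..<K}) k)"
        by (subst sum_limit_weight[symmetric])
          (auto simp: indicator_def if_distrib[of "\<lambda>z. _ * z"] sum.If_cases Int_def conj_commute cong: if_cong)
      ultimately show ?thesis
        using n[rule_format, of "indicator (A \<inter> {..<K})" K] by (simp add: indicator_def)
    qed
    have incseq: "incseq (\<lambda>K. A \<inter> {..<K})" by (auto simp: incseq_def)
    have union: "(\<Union>K. A \<inter> {..<K}) = A" by auto
    have "(\<lambda>K. measure M (A \<inter> {..<K})) \<longlonglongrightarrow> measure M (\<Union>K. A \<inter> {..<K})"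
      unfolding M_def by (rule measure_pmf.finite_Lim_measure_incseq[OF _ incseq]) auto
    moreover have "(\<lambda>K. measure (limit_degree \<beta> \<epsilon>) (A \<inter> {..<K})) \<longlonglongrightarrow>
        measure (limit_degree \<beta> \<epsilon>) (\<Union>K. A \<inter> {..<K})"
      by (rule L.finite_Lim_measure_incseq[OF _ incseq]) (simp add: sets)
    ultimately have "(\<lambda>K. \<bar>measure M (A \<inter> {..<K}) - measure (limit_degree \<beta> \<epsilon>) (A \<inter> {..<K})\<bar>)
        \<longlonglongrightarrow> \<bar>measure M A - measure (limit_degree \<beta> \<epsilon>) A\<bar>"
      unfolding union by (intro tendsto_rabs tendsto_diff)
    then show "\<bar>measure (measure_pmf (root_degree \<beta> \<epsilon> n)) A - measure (limit_degree \<beta> \<epsilon>) A\<bar> \<le> B / sqrt (real n)"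
      unfolding M_def[symmetric] by (rule LIMSEQ_le_const2) (use fin in auto)
  qed simp
  show ?thesis by (rule exI, rule eventually_mono[OF close tv])
qed

end

theorem corollary1p4:
  fixes \<beta> \<epsilon> p :: real
  assumes "\<beta> > 0" and "0 < \<epsilon>" and "\<epsilon> \<le> 1 / 2" and "p = 1 / 2 + \<epsilon>"
  shows "\<forall>\<^sub>F n in sequentially.
           tv_dist (measure_pmf (root_degree \<beta> \<epsilon> n)) (limit_degree \<beta> \<epsilon>)
             \<le> ln (ln (real n)) powr (- (p / (2 * \<epsilon>)))"
proof -
  interpret drgvr_params \<beta> \<epsilon> p using assms by unfold_locales auto
  obtain B where close: "\<forall>\<^sub>F n in sequentially.
      tv_dist (measure_pmf (root_degree \<beta> \<epsilon> n)) (limit_degree \<beta> \<epsilon>) \<le> B / sqrt (real n)"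
    using tv_dist_root_degree ..
  define c where "c = p / (2 * \<epsilon>)"
  have "c > 0" using assms by (simp add: c_def)
  \<comment> \<open>A negative power of ln (ln n) decays more slowly than 1 / sqrt n times any
    constant, so no control of B is required.\<close>
  have "\<forall>\<^sub>F n in sequentially. \<bar>B\<bar> / sqrt (real n) \<le> ln (ln (real n)) powr (- c)"
    using \<open>c > 0\<close> by real_asymp
  then show ?thesis
    using close
  proof eventually_elim
    case (elim n)
    have "B / sqrt (real n) \<le> \<bar>B\<bar> / sqrt (real n)" by (intro divide_right_mono) auto
    then show ?case using elim by (simp add: c_def)
  qed
qed

end
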